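(* Let the number of markets $m$ be fixed. There exists a polynomial time algorithm for separating over the polyhedron of feasible solutions of $(M^k)$ for the multi market uncapacitated production-distribution game with $m$ markets. That is, given such a game $(N,v)$, the data $S_1,\dots,S_k$ and $c^k(S_1),\dots,c^k(S_k)$ defining $(M^k)$, and a point $(\bar x,\bar\epsilon)\in\mathbb{R}^{n}\times\mathbb{R}$, the algorithm decides whether $(\bar x,\bar\epsilon)$ satisfies all constraints of $(M^k)$ and, if not, outputs a constraint of $(M^k)$ violated by $(\bar x,\bar\epsilon)$.
   Context: Multi market uncapacitated production-distribution game: players $N=\{1,\dots,n\}$, markets $M=\{1,\dots,m\}$, per-unit profits $\alpha_{ij}\ge 0$ and demands $d_{ij}\ge 0$ for $i\in N$, $j\in M$; the value of a nonempty $S\subseteq N$ is $$v(S)=\sum_{j\in M}\Big(\sum_{i\in S}d_{ij}\Big)\cdot\max_{k\in S}\alpha_{kj},$$ and $v(\emptyset)=0$. For $x\in\mathbb{R}^n$, $x(S)=\sum_{i\in S}x_i$. Subsets of $N$ are identified with their characteristic vectors in $\mathbb{R}^n$, so $S\in\mathrm{span}\{S_1,\dots,S_k\}$ refers to the linear span of characteristic vectors. The linear program $(M^k)$: given $S_1,\dots,S_k\subseteq N$ with linearly independent characteristic vectors, $1\le k\le n$, $S_1=N$, and numbers $c^k(S_1),\dots,c^k(S_k)$ with $c^k(N)=v(N)$, $$\max\ \epsilon\quad\text{s.t.}\quad x(S)\ge v(S)+\epsilon\ \ \forall S\subseteq N,\ S\notin\mathrm{span}\{S_1,\dots,S_k\};\qquad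 x(S)=c^k(S)\ \ \forall S\in\{S_1,\dots,S_k\},$$ in variables $(x,\epsilon)\in\mathbb{R}^n\times\mathbb{R}$. These programs arise as the iterations of a scheme for computing the nucleolus $\nu$ of $(N,v)$, in which $c^k(S_l)$ is the (already determined) value $\nu(S_l)$. The nucleolus is the unique $x$ with $x(N)=v(N)$ maximizing lexicographically the vector of all excesses $x(S)-v(S)$, $S\subseteq N$, sorted in non-decreasing order. Polynomial time is with respect to the encoding length of the rational input data $\alpha,d,S_1,\dots,S_k,c^k,\bar x,\bar\epsilon$, with $m$ a constant (the polynomial may depend on $m$). *)

theory Defs
  imports
    Complex_Main
    "HOL-Library.Function_Algebras"
    "HOL-Library.Indicator_Function"
    "HOL-Library.Log_Nat"
    "HOL-Computational_Algebra.Polynomial"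
begin

section \<open>The game\<close>

text \<open>Players are \<open>{..<n}\<close>, markets are \<open>{..<m}\<close>.\<close>

definition game_value ::
    "nat \<Rightarrow> (nat \<Rightarrow> nat \<Rightarrow> real) \<Rightarrow> (nat \<Rightarrow> nat \<Rightarrow> real) \<Rightarrow> nat set \<Rightarrow> real" where
  "game_value m \<alpha> d S =
     (if S = {} then 0
      else (\<Sum>j<m. (\<Sum>i\<in>S. d i j) * Max ((\<lambda>k. \<alpha> k j) ` S)))"


section \<open>The constraints of the linear program\<close>

text \<open>
  Linear algebra takes place in \<open>nat \<Rightarrow> real\<close> with pointwise operations, so that \<open>n\<close> can vary.
  Characteristic vectors of subsets of \<open>{..<n}\<close> vanish outside \<open>{..<n}\<close>; their
  linear spans and linear dependencies are therefore the ones of \<open>n\<close>-dimensional real space.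
\<close>

interpretation coord: vector_space "\<lambda>(c::real) (f::nat \<Rightarrow> real) i. c * f i"
  by unfold_locales (auto simp: algebra_simps)

abbreviation char_vec :: "nat set \<Rightarrow> nat \<Rightarrow> real" where
  "char_vec S \<equiv> indicator S"

text \<open>
  The family is given as a list, with its first member at index \<open>0\<close>. As \<open>char_vec\<close> is
  injective, linear independence of the family of characteristic vectors means that
  the list has no repetitions and that the set of characteristic vectors is independent.
\<close>

definition independent_family :: "nat set list \<Rightarrow> bool" where
  "independent_family Ss \<longleftrightarrow> distinct Ss \<and> coord.independent (char_vec ` set Ss)"

datatype lp_constraint =
    Inequality "nat set"  \<comment> \<open>\<open>x(S) \<ge> v(S) + \<epsilon>\<close>\<close>
  | Equality "nat set"    \<comment> \<open>\<open>x(S) = c(S)\<close>\<close>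

definition lp_constraints :: "nat \<Rightarrow> nat set list \<Rightarrow> lp_constraint set" where
  "lp_constraints n Ss =
     {Inequality S | S. S \<subseteq> {..<n} \<and> char_vec S \<notin> coord.span (char_vec ` set Ss)} \<union>
     {Equality S | S. S \<in> set Ss}"

fun satisfies ::
    "(nat set \<Rightarrow> real) \<Rightarrow> (nat set \<Rightarrow> real) \<Rightarrow> (nat \<Rightarrow> real) \<times> real \<Rightarrow> lp_constraint \<Rightarrow> bool" where
  "satisfies v c (x, \<epsilon>) (Inequality S) \<longleftrightarrow> (\<Sum>i\<in>S. x i) \<ge> v S + \<epsilon>"
| "satisfies v c (x, \<epsilon>) (Equality S) \<longleftrightarrow> (\<Sum>i\<in>S. x i) = c S"


section \<open>Instances of the separation problem\<close>

text \<open>The number \<open>m\<close> of markets is not part of an instance; it is a parameter throughout.\<close>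

record sep_instance =
  players :: nat
  profit :: "nat \<Rightarrow> nat \<Rightarrow> rat"
  demand :: "nat \<Rightarrow> nat \<Rightarrow> rat"
  family :: "nat set list"
  fixed :: "nat set \<Rightarrow> rat"
  point :: "nat \<Rightarrow> rat"
  level :: rat

definition inst_value :: "nat \<Rightarrow> sep_instance \<Rightarrow> nat set \<Rightarrow> real" where
  "inst_value m I =
     game_value m (\<lambda>i j. of_rat (profit I i j)) (\<lambda>i j. of_rat (demand I i j))"

definition inst_fixed :: "sep_instance \<Rightarrow> nat set \<Rightarrow> real" where
  "inst_fixed I S = of_rat (fixed I S)"

definition inst_point :: "sep_instance \<Rightarrow> (nat \<Rightarrow> real) \<times> real" where
  "inst_point I = (\<lambda>i. of_rat (point I i), of_rat (level I))"

definition valid_instance :: "nat \<Rightarrow> sep_instance \<Rightarrow> bool" where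
  "valid_instance m I \<longleftrightarrow>
     (\<forall>i<players I. \<forall>j<m. profit I i j \<ge> 0 \<and> demand I i j \<ge> 0) \<and>
     1 \<le> length (family I) \<and> length (family I) \<le> players I \<and>
     (\<forall>S\<in>set (family I). S \<subseteq> {..<players I}) \<and>
     family I ! 0 = {..<players I} \<and>
     independent_family (family I) \<and>
     inst_fixed I {..<players I} = inst_value m I {..<players I}"

text \<open>
  \<open>None\<close> is the answer ``feasible'', \<open>Some con\<close> reports the violated constraint \<open>con\<close>.
\<close>

fun correct_answer :: "nat \<Rightarrow> sep_instance \<Rightarrow> lp_constraint option \<Rightarrow> bool" where
  "correct_answer m I None \<longleftrightarrow>
     (\<forall>con \<in> lp_constraints (players I) (family I).
        satisfies (inst_value m I) (inst_fixed I) (inst_point I) con)"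
| "correct_answer m I (Some con) \<longleftrightarrow>
     con \<in> lp_constraints (players I) (family I) \<and>
     \<not> satisfies (inst_value m I) (inst_fixed I) (inst_point I) con"


section \<open>Programs and their running time\<close>

text \<open>
  The model of computation is a random access machine over the integers with logarithmic cost,
  programmed by structured commands. The memory consists of named arrays of integers, of which a
  program mentions only finitely many. Evaluating an expression costs the total bit length of the
  values of all its subexpressions, including array indices. Hence neither large numbers nor
  large addresses are available for free, and running times are polynomially related to those of
  Turing machines.
\<close>

definition bits :: "int \<Rightarrow> nat" where
  "bits z = 1 + floorlog 2 (nat \<bar>z\<bar>)"

type_synonym memory = "string \<Rightarrow> int \<Rightarrow> int"

datatype expr =
    Const int
  | Read string expr
  | Add expr expr
  | Sub expr expr
  | Mul expr expr
  | Div expr expr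

fun val :: "expr \<Rightarrow> memory \<Rightarrow> int" where
  "val (Const z) s = z"
| "val (Read a e) s = s a (val e s)"
| "val (Add e f) s = val e s + val f s"
| "val (Sub e f) s = val e s - val f s"
| "val (Mul e f) s = val e s * val f s"
| "val (Div e f) s = val e s div val f s"

fun cost :: "expr \<Rightarrow> memory \<Rightarrow> nat" where
  "cost (Const z) s = bits z"
| "cost (Read a e) s = cost e s + bits (val (Read a e) s)"
| "cost (Add e f) s = cost e s + cost f s + bits (val (Add e f) s)"
| "cost (Sub e f) s = cost e s + cost f s + bits (val (Sub e f) s)"
| "cost (Mul e f) s = cost e s + cost f s + bits (val (Mul e f) s)"
| "cost (Div e f) s = cost e s + cost f s + bits (val (Div e f) s)"

datatype program =
    Skip
  | Write string expr expr  \<comment> \<open>array, index, new value\<close>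
  | Seq program program
  | IfPos expr program program
  | WhilePos expr program

text \<open>\<open>exec p s t s'\<close>: started in memory \<open>s\<close>, \<open>p\<close> terminates in memory \<open>s'\<close> after time \<open>t\<close>.\<close>

inductive exec :: "program \<Rightarrow> memory \<Rightarrow> nat \<Rightarrow> memory \<Rightarrow> bool" where
  Skip: "exec Skip s 1 s"
| Write: "exec (Write a e f) s (1 + cost e s + cost f s) (s(a := (s a)(val e s := val f s)))"
| Seq: "exec p s t s' \<Longrightarrow> exec q s' u s'' \<Longrightarrow> exec (Seq p q) s (1 + t + u) s''"
| IfTrue: "val e s > 0 \<Longrightarrow> exec p s t s' \<Longrightarrow> exec (IfPos e p q) s (1 + cost e s + t) s'"
| IfFalse: "\<not> val e s > 0 \<Longrightarrow> exec q s t s' \<Longrightarrow> exec (IfPos e p q) s (1 + cost e s + t) s'"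
| WhileFalse: "\<not> val e s > 0 \<Longrightarrow> exec (WhilePos e p) s (1 + cost e s) s"
| WhileTrue: "val e s > 0 \<Longrightarrow> exec p s t s' \<Longrightarrow> exec (WhilePos e p) s' u s'' \<Longrightarrow>
    exec (WhilePos e p) s (1 + cost e s + t + u) s''"

lemma exec_deterministic:
  "exec p s t s' \<Longrightarrow> exec p s u s'' \<Longrightarrow> t = u \<and> s' = s''"
proof (induction arbitrary: u s'' rule: exec.induct)
  case (Seq p s t s1 q v s2)
  from Seq.prems obtain t' v' s1' where "exec p s t' s1'" "exec q s1' v' s''" "u = 1 + t' + v'"
    by (cases rule: exec.cases) auto
  with Seq.IH show ?case by metis
next
  case (WhileTrue e s p t s1 v s2)
  from WhileTrue.prems WhileTrue.hyps(1) obtain t' v' s1'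
    where "exec p s t' s1'" "exec (WhilePos e p) s1' v' s''" "u = 1 + cost e s + t' + v'"
    by (cases rule: exec.cases) auto
  with WhileTrue.IH show ?case by metis
next
  case (IfTrue e s p t s1 q)
  from IfTrue.prems IfTrue.hyps(1) obtain t' where "exec p s t' s''" "u = 1 + cost e s + t'"
    by (cases rule: exec.cases) auto
  with IfTrue.IH show ?case by metis
next
  case (IfFalse e s q t s1 p)
  from IfFalse.prems IfFalse.hyps(1) obtain t' where "exec q s t' s''" "u = 1 + cost e s + t'"
    by (cases rule: exec.cases) auto
  with IfFalse.IH show ?case by metis
qed (erule exec.cases; simp)+


section \<open>Input and output\<close>

text \<open>
  Rationals are written as numerator and positive denominator in lowest terms, subsets of
  \<open>{..<n}\<close> as lists of \<open>n\<close> zeros and ones.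
\<close>

definition enc_rat :: "rat \<Rightarrow> int list" where
  "enc_rat q = [fst (quotient_of q), snd (quotient_of q)]"

definition enc_set :: "nat \<Rightarrow> nat set \<Rightarrow> int list" where
  "enc_set n S = map (\<lambda>i. if i \<in> S then 1 else 0) [0..<n]"

definition enc_matrix :: "nat \<Rightarrow> nat \<Rightarrow> (nat \<Rightarrow> nat \<Rightarrow> rat) \<Rightarrow> int list" where
  "enc_matrix n m A = concat (map (\<lambda>i. concat (map (\<lambda>j. enc_rat (A i j)) [0..<m])) [0..<n])"

definition enc_instance :: "nat \<Rightarrow> sep_instance \<Rightarrow> int list" where
  "enc_instance m I =
     [int (players I), int (length (family I))] @
     enc_matrix (players I) m (profit I) @
     enc_matrix (players I) m (demand I) @
     concat (map (enc_set (players I)) (family I)) @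
     concat (map (\<lambda>S. enc_rat (fixed I S)) (family I)) @
     concat (map (\<lambda>i. enc_rat (point I i)) [0..<players I]) @
     enc_rat (level I)"

definition encoding_length :: "int list \<Rightarrow> nat" where
  "encoding_length zs = sum_list (map bits zs)"

definition initial_memory :: "int list \<Rightarrow> memory" where
  "initial_memory zs a i =
     (if a = ''in'' \<and> 0 \<le> i \<and> i < int (length zs) then zs ! nat i else 0)"

text \<open>
  Cell \<open>0\<close> of the array \<open>out\<close> holds the kind of the answer (\<open>0\<close>: feasible, \<open>1\<close>: violated
  inequality, otherwise: violated equality), cells \<open>1, \<dots>, n\<close> the characteristic vector of
  the set indexing the violated constraint.
\<close>

definition decode_answer :: "nat \<Rightarrow> memory \<Rightarrow> lp_constraint option" where
  "decode_answer n s =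
     (let out = s ''out''; S = {i. i < n \<and> out (1 + int i) \<noteq> 0}
      in if out 0 = 0 then None
         else if out 0 = 1 then Some (Inequality S)
         else Some (Equality S))"

end

theory Submission
  imports "Jordan_Normal_Form.Determinant" Defs
begin

text \<open>
  Fix for every market \<open>j\<close> a player \<open>K j\<close>; this gives \<open>n ^ m\<close> choices. For a coalition \<open>S\<close> containing all
  \<open>K j\<close>, replacing the maximal profits in \<open>v S\<close> by those of the players \<open>K j\<close> bounds \<open>x(S) - v(S)\<close> from
  above by a sum of weights over the members of \<open>S\<close>, with equality if the \<open>K j\<close> attain the maxima. Among
  all \<open>S\<close> containing the \<open>K j\<close>, this sum is least if \<open>S\<close> adds the players of negative weight. If that coalition lies in
  the excluded span, the best one outside the span is obtained by exchanging one further player. So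
  only \<open>n ^ m * (n + 1)\<close> coalitions have to be tested. Membership in the span is decided by
  fraction-free Gauss--Jordan elimination, whose intermediate numbers are, up to sign, sums of
  at most \<open>k\<close> minors of a 0/1 matrix and hence have polynomially many bits.
\<close>

section \<open>Reasoning about programs\<close>

text \<open>Testing an upper bound of the excess suffices in both directions. If the weights of a
  tested coalition sum to less than the level, its excess is below the level too, so the reported
  constraint is violated. Conversely, a violated coalition, paired with players attaining its
  maxima, has weight sum equal to its excess, and some tested coalition for that choice does no
  worse. A fixed program runs in time polynomial in the largest number of rounds of a loop and the
  largest bit length of a cell. The complexity analysis therefore reduces to counting rounds and to
  bounding every stored value by one number \<open>H\<close>. Two obstacles arise. Rational
  arithmetic is avoided by scaling with a common multiple \<open>\<Delta>\<close> of the
  denominators; as demands multiply profits, inequalities are compared after multiplication by its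
  square. Elimination by cross-multiplication alone could double the bit lengths at each pivot.
  Dividing by the previous pivot prevents this, and Cramer's rule, which bounds the entries, also
  shows that the division is exact.\<close>

lemma bits_ge_1: "1 \<le> bits z"
  by (simp add: bits_def)

lemma bits_mono: "\<bar>x\<bar> \<le> \<bar>y\<bar> \<Longrightarrow> bits x \<le> bits y"
  unfolding bits_def by (intro add_left_mono floorlog_mono) auto

lemma abs_less_bits: "\<bar>z\<bar> < 2 ^ (bits z - 1)"
proof -
  have "nat \<bar>z\<bar> < 2 ^ floorlog 2 (nat \<bar>z\<bar>)"
    using floorlog_bounds[of "nat \<bar>z\<bar>" 2] by (cases "z = 0") (auto simp: floorlog_def)
  then have "int (nat \<bar>z\<bar>) < int (2 ^ floorlog 2 (nat \<bar>z\<bar>))" by (simp only: of_nat_less_iff)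
  then show ?thesis by (simp add: bits_def)
qed

lemma bits_le_iff: "bits z \<le> Suc h \<longleftrightarrow> \<bar>z\<bar> < 2 ^ h"
proof
  assume "bits z \<le> Suc h"
  then have "(2::int) ^ (bits z - 1) \<le> 2 ^ h" by (intro power_increasing) auto
  with abs_less_bits[of z] show "\<bar>z\<bar> < 2 ^ h" by linarith
next
  assume "\<bar>z\<bar> < 2 ^ h"
  then have "nat \<bar>z\<bar> < 2 ^ h" by (simp add: nat_less_iff)
  then have "floorlog 2 (nat \<bar>z\<bar>) \<le> h"
    using floorlog_le_iff[of 2 "nat \<bar>z\<bar>" h] by simp
  then show "bits z \<le> Suc h" by (simp add: bits_def)
qed

text \<open>The unit that \<open>bits\<close> adds to each operand pays for the carry of an
  addition. The three alternatives of the assumption cover sums and differences, products, and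
  quotients.\<close>

lemma bits_bin:
  assumes "\<bar>z\<bar> \<le> \<bar>x\<bar> + \<bar>y\<bar> \<or> \<bar>z\<bar> \<le> \<bar>x\<bar> * \<bar>y\<bar> \<or> \<bar>z\<bar> \<le> \<bar>x\<bar>"
  shows "bits z \<le> bits x + bits y"
proof -
  define a b where "a = bits x - 1" and "b = bits y - 1"
  have ab: "bits x = Suc a" "bits y = Suc b"
    using bits_ge_1[of x] bits_ge_1[of y] by (auto simp: a_def b_def)
  have x: "\<bar>x\<bar> < 2 ^ a" and y: "\<bar>y\<bar> < 2 ^ b"
    using bits_le_iff[of x a] bits_le_iff[of y b] ab by auto
  have m: "(2::int) ^ a \<le> 2 ^ (a + b)" "(2::int) ^ b \<le> 2 ^ (a + b)"
    by (auto intro: power_increasing)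
  have xy: "\<bar>x\<bar> + \<bar>y\<bar> < 2 ^ Suc (a + b)"
    using x y m unfolding power_Suc by linarith
  have "\<bar>z\<bar> < 2 ^ Suc (a + b)"
    using assms
  proof (elim disjE)
    assume "\<bar>z\<bar> \<le> \<bar>x\<bar> * \<bar>y\<bar>"
    also have "\<dots> \<le> 2 ^ a * 2 ^ b" using x y by (intro mult_mono) auto
    also have "\<dots> = 2 ^ (a + b)" by (simp add: power_add)
    also have "\<dots> < (2::int) ^ Suc (a + b)" by simp
    finally show ?thesis .
  qed (use xy in linarith)+
  then show ?thesis using bits_le_iff[of z "Suc (a + b)"] ab by simp
qed

text \<open>\<open>div\<close> rounds down, so negative quotients are rounded away from zero; for
  integers this still cannot exceed the dividend, and division by zero yields 0.\<close>

lemma abs_div_le: "\<bar>a div b\<bar> \<le> \<bar>a :: int\<bar>"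
proof -
  have pos: "\<bar>x div c\<bar> \<le> \<bar>x\<bar>" if c: "0 < c" for x c :: int
  proof (cases "0 \<le> x")
    case True
    then show ?thesis using c zdiv_mono2[of x 1 c] pos_imp_zdiv_nonneg_iff[of c x] by simp
  next
    case False
    then show ?thesis using c zdiv_mono2_neg[of x 1 c] pos_imp_zdiv_neg_iff[of c x] by simp
  qed
  consider "b = 0" | "0 < b" | "b < 0" by linarith
  then show ?thesis
  proof cases
    case 3
    then show ?thesis using pos[of "- b" "- a"] by simp
  qed (simp_all add: pos)
qed

section \<open>Size and cost of expressions\<close>

fun esize :: "expr \<Rightarrow> nat" where
  "esize (Const z) = bits z"
| "esize (Read a e) = 1 + esize e"
| "esize (Add e f) = 1 + esize e + esize f"
| "esize (Sub e f) = 1 + esize e + esize f"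
| "esize (Mul e f) = 1 + esize e + esize f"
| "esize (Div e f) = 1 + esize e + esize f"

text \<open>A \<open>Read\<close> resets the bound to \<open>W\<close> whatever its address is, and
  a binary operation at most adds bit lengths by \<open>bits_bin\<close>; hence growth is linear in
  the syntactic size.\<close>

lemma bits_val:
  assumes "\<And>a i. bits (s a i) \<le> W" "1 \<le> W"
  shows "bits (val e s) \<le> W * esize e"
proof (induction e)
  case (Const z)
  then show ?case using assms(2) by simp
next
  case (Read a e)
  then show ?case using assms by (simp add: trans_le_add1)
next
  case (Add e f)
  then show ?case using bits_bin[of "val e s + val f s" "val e s" "val f s"]
    by (simp add: algebra_simps abs_triangle_ineq)
next
  case (Sub e f)
  then show ?case using bits_bin[of "val e s - val f s" "val e s" "val f s"]
    by (simp add: algebra_simps abs_triangle_ineq4)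
next
  case (Mul e f)
  then show ?case using bits_bin[of "val e s * val f s" "val e s" "val f s"]
    by (simp add: algebra_simps abs_mult)
next
  case (Div e f)
  then show ?case using bits_bin[of "val e s div val f s" "val e s" "val f s"]
    by (simp add: algebra_simps abs_div_le)
qed

text \<open>The cost adds up the sizes of the values of all subexpressions. There are at most
  \<open>esize e\<close> of them, each bounded by \<open>bits_val\<close>, whence the
  square.\<close>

lemma cost_le:
  assumes "\<And>a i. bits (s a i) \<le> W" "1 \<le> W"
  shows "cost e s \<le> W * (esize e)\<^sup>2"
proof -
  have bin: "W * x\<^sup>2 + W * y\<^sup>2 + W * (1 + x + y) \<le> W * (1 + x + y)\<^sup>2" for x y :: nat
  proof -
    have "x\<^sup>2 + y\<^sup>2 + (1 + x + y) \<le> (1 + x + y)\<^sup>2" by (simp add: power2_eq_square algebra_simps)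
    from mult_left_mono[OF this, of W] show ?thesis by (simp add: algebra_simps)
  qed
  note v = bits_val[of s W, OF assms]
  show ?thesis
  proof (induction e)
    case (Const z)
    have "bits z * 1 \<le> bits z * (bits z * W)"
      using bits_ge_1[of z] assms(2) by (intro mult_left_mono) (simp_all add: Suc_le_eq)
    then show ?case by (simp add: power2_eq_square algebra_simps)
  next
    case (Read a e)
    have "W * (esize e)\<^sup>2 + W \<le> W * (1 + esize e)\<^sup>2"
      by (simp add: power2_eq_square algebra_simps)
    with Read assms(1)[of a "val e s"] show ?case by simp
  next
    case (Add e f)
    then show ?case using bin[of "esize e" "esize f"] v[of "Add e f"] by simp
  next
    case (Sub e f)
    then show ?case using bin[of "esize e" "esize f"] v[of "Sub e f"] by simp
  next
    case (Mul e f)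
    then show ?case using bin[of "esize e" "esize f"] v[of "Mul e f"] by simp
  next
    case (Div e f)
    then show ?case using bin[of "esize e" "esize f"] v[of "Div e f"] by simp
  qed
qed

section \<open>Execution within bounds on time and memory\<close>

fun writes :: "program \<Rightarrow> string set" where
  "writes Skip = {}"
| "writes (Write a e f) = {a}"
| "writes (Seq p q) = writes p \<union> writes q"
| "writes (IfPos e p q) = writes p \<union> writes q"
| "writes (WhilePos e p) = writes p"

lemma exec_frame: "exec p s t s' \<Longrightarrow> a \<notin> writes p \<Longrightarrow> s' a = s a"
  by (induction rule: exec.induct) auto

text \<open>Running time if every loop makes at most \<open>b\<close> rounds and all cells have at most \<open>W\<close> bits.\<close>

fun time_bound :: "nat \<Rightarrow> nat \<Rightarrow> program \<Rightarrow> nat" where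
  "time_bound b W Skip = 1"
| "time_bound b W (Write a e f) = 1 + W * (esize e)\<^sup>2 + W * (esize f)\<^sup>2"
| "time_bound b W (Seq p q) = 1 + time_bound b W p + time_bound b W q"
| "time_bound b W (IfPos e p q) = 1 + W * (esize e)\<^sup>2 + time_bound b W p + time_bound b W q"
| "time_bound b W (WhilePos e p) =
    (1 + W * (esize e)\<^sup>2) + b * (1 + W * (esize e)\<^sup>2 + time_bound b W p)"

definition small :: "int \<Rightarrow> memory \<Rightarrow> bool" where
  "small H s \<longleftrightarrow> (\<forall>a i. \<bar>s a i\<bar> \<le> H)"

text \<open>A Hoare triple for total correctness that carries the time bound along. Smallness is
  built in before and after, so assertions need not mention it. Only stored values must stay below
  \<open>H\<close>; values inside expressions may exceed it and are accounted for by
  \<open>esize\<close>.\<close>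

definition runs :: "nat \<Rightarrow> int \<Rightarrow> program \<Rightarrow> memory \<Rightarrow> (memory \<Rightarrow> bool) \<Rightarrow> bool" where
  "runs b H p s Q \<longleftrightarrow> (small H s \<longrightarrow>
     (\<exists>t s'. exec p s t s' \<and> t \<le> time_bound b (bits H) p \<and> small H s' \<and> Q s'))"

lemma small_bits: "small H s \<Longrightarrow> bits (s a i) \<le> bits H"
  unfolding small_def by (intro bits_mono) (meson abs_ge_self order_trans)

lemma small_cost: "small H s \<Longrightarrow> cost e s \<le> bits H * (esize e)\<^sup>2"
  by (intro cost_le small_bits bits_ge_1)

abbreviation agree :: "string set \<Rightarrow> memory \<Rightarrow> memory \<Rightarrow> bool" where
  "agree A s s' \<equiv> (\<forall>a. a \<notin> A \<longrightarrow> s' a = s a)"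

lemma runs_conseq:
  assumes "runs b H p s Q"
    and "\<And>s'. agree (writes p) s s' \<Longrightarrow> Q s' \<Longrightarrow> R s'"
  shows "runs b H p s R"
  using assms exec_frame unfolding runs_def by metis

lemma runs_Skip: "Q s \<Longrightarrow> runs b H Skip s Q"
  unfolding runs_def using exec.Skip by fastforce

abbreviation put :: "string \<Rightarrow> int \<Rightarrow> int \<Rightarrow> memory \<Rightarrow> memory" where
  "put a i z s \<equiv> s(a := (s a)(i := z))"

lemma runs_Write:
  assumes "\<bar>val f s\<bar> \<le> H" "Q (put a (val e s) (val f s) s)"
  shows "runs b H (Write a e f) s Q"
proof -
  have "small H s \<Longrightarrow> small H (put a (val e s) (val f s) s)"
    using assms(1) by (simp add: small_def)
  moreover have "small H s \<Longrightarrow> 1 + cost e s + cost f s \<le> time_bound b (bits H) (Write a e f)"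
    using small_cost[of H s e] small_cost[of H s f] by simp
  ultimately show ?thesis unfolding runs_def using exec.Write[of a e f s] assms(2) by blast
qed

lemma runs_Seq:
  assumes "runs b H p s R" and "\<And>s'. agree (writes p) s s' \<Longrightarrow> R s' \<Longrightarrow> runs b H q s' Q"
  shows "runs b H (Seq p q) s Q"
  unfolding runs_def
proof
  assume "small H s"
  then obtain t s' where p: "exec p s t s'" "t \<le> time_bound b (bits H) p" "small H s'" "R s'"
    using assms(1) unfolding runs_def by blast
  have "runs b H q s' Q" using assms(2) p exec_frame by blast
  then obtain u s'' where q: "exec q s' u s''" "u \<le> time_bound b (bits H) q" "small H s''" "Q s''"
    using p(3) unfolding runs_def by blast
  have "1 + t + u \<le> time_bound b (bits H) (Seq p q)" using p q by simp
  then show "\<exists>t s'. exec (Seq p q) s t s' \<and> t \<le> time_bound b (bits H) (Seq p q) \<and> small H s' \<and> Q s'"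
    using exec.Seq[OF p(1) q(1)] q by blast
qed

lemma runs_IfPos:
  assumes "val e s > 0 \<Longrightarrow> runs b H p s Q" "\<not> val e s > 0 \<Longrightarrow> runs b H q s Q"
  shows "runs b H (IfPos e p q) s Q"
  unfolding runs_def
proof
  assume s: "small H s"
  note c = small_cost[OF s, of e]
  show "\<exists>t s'. exec (IfPos e p q) s t s' \<and> t \<le> time_bound b (bits H) (IfPos e p q) \<and> small H s' \<and> Q s'"
  proof (cases "val e s > 0")
    case True
    then obtain t s' where "exec p s t s'" "t \<le> time_bound b (bits H) p" "small H s'" "Q s'"
      using assms(1) s unfolding runs_def by blast
    then show ?thesis using exec.IfTrue[OF True, of p t s' q] c
      by (intro exI[of _ "1 + cost e s + t"] exI[of _ s']) simp
  next
    case False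
    then obtain t s' where "exec q s t s'" "t \<le> time_bound b (bits H) q" "small H s'" "Q s'"
      using assms(2) s unfolding runs_def by blast
    then show ?thesis using exec.IfFalse[OF False, of q t s' p] c
      by (intro exI[of _ "1 + cost e s + t"] exI[of _ s']) simp
  qed
qed

text \<open>Indexing the invariant by the completed rounds, with the exact count known in advance,
  yields termination and the time bound together.\<close>

lemma runs_WhilePos:
  assumes "Inv 0 s" "cnt \<le> b"
    and "\<And>i s'. i < cnt \<Longrightarrow> Inv i s' \<Longrightarrow> val e s' > 0 \<and> runs b H p s' (Inv (Suc i))"
    and "\<And>s'. Inv cnt s' \<Longrightarrow> \<not> val e s' > 0"
  shows "runs b H (WhilePos e p) s (Inv cnt)"
proof -
  define T where "T = 1 + bits H * (esize e)\<^sup>2"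
  \<comment> \<open>The time still to be spent depends on the rounds left, so the induction goes
    downwards from \<open>cnt\<close>.\<close>
  have "\<exists>t s'. exec (WhilePos e p) s t s' \<and> t \<le> T + (cnt - i) * (T + time_bound b (bits H) p)
      \<and> small H s' \<and> Inv cnt s'" if "Inv i s" "i \<le> cnt" "small H s" for i s
    using that(2,1,3)
  proof (induction i arbitrary: s rule: inc_induct)
    case base
    then show ?case using exec.WhileFalse[of e s p] assms(4) small_cost[of H s e]
      by (intro exI[of _ "1 + cost e s"] exI[of _ s]) (simp add: T_def)
  next
    case (step i)
    have v: "val e s > 0" and "runs b H p s (Inv (Suc i))" using assms(3) step by auto
    then obtain t s' where p: "exec p s t s'" "t \<le> time_bound b (bits H) p" "small H s'" "Inv (Suc i) s'"
      using step.prems unfolding runs_def by blast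
    obtain u s'' where w: "exec (WhilePos e p) s' u s''"
      "u \<le> T + (cnt - Suc i) * (T + time_bound b (bits H) p)" "small H s''" "Inv cnt s''"
      using step.IH p by blast
    have "cnt - i = Suc (cnt - Suc i)" using step by simp
    then have "1 + cost e s + t + u \<le> T + (cnt - i) * (T + time_bound b (bits H) p)"
      using p(2) w(2) small_cost[OF step.prems(2), of e] by (simp add: T_def)
    then show ?case using exec.WhileTrue[OF v p(1) w(1)] w by blast
  qed
  from this[of 0 s] assms(1)
  have ex: "small H s \<Longrightarrow> \<exists>t s'. exec (WhilePos e p) s t s' \<and>
     t \<le> T + cnt * (T + time_bound b (bits H) p) \<and> small H s' \<and> Inv cnt s'" by simp
  have "T + cnt * (T + time_bound b (bits H) p) \<le> time_bound b (bits H) (WhilePos e p)"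
    using assms(2) by (simp add: T_def del: mult_Suc_right add_mult_distrib2)
  then show ?thesis unfolding runs_def using ex order_trans by blast
qed

section \<open>Counting loops\<close>

abbreviation (input) Var :: "string \<Rightarrow> expr" where
  "Var x \<equiv> Read x (Const 0)"

definition For :: "string \<Rightarrow> expr \<Rightarrow> program \<Rightarrow> program" where
  "For v e p = Seq (Write v (Const 0) (Const 0))
     (WhilePos (Sub e (Var v)) (Seq p (Write v (Const 0) (Add (Var v) (Const 1)))))"

lemma writes_For [simp]: "writes (For v e p) = insert v (writes p)"
  by (simp add: For_def)

text \<open>The limit \<open>e\<close> is evaluated again before each round, so its value has to
  survive all writes of the loop. The next invariant is claimed of the memory with the counter
  already advanced, and \<open>cnt\<close> must be at most \<open>H\<close> because the counter is
  itself a cell.\<close>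

lemma runs_For:
  assumes cnt: "cnt \<le> b" "int cnt \<le> H"
    and v: "v \<notin> writes p"
    and e: "\<And>s'. agree (insert v (writes p)) s s' \<Longrightarrow> val e s' = int cnt"
    and start: "Inv 0 (put v 0 0 s)"
    and step: "\<And>i s'. i < cnt \<Longrightarrow> agree (insert v (writes p)) s s' \<Longrightarrow> s' v 0 = int i \<Longrightarrow> Inv i s' \<Longrightarrow>
      runs b H p s' (\<lambda>s''. Inv (Suc i) (put v 0 (int i + 1) s''))"
  shows "runs b H (For v e p) s (Inv cnt)"
proof -
  \<comment> \<open>Adds the frame and the value of the counter to \<open>Inv\<close>, so that
    applications of the rule need not carry them.\<close>
  define J where "J i s' \<longleftrightarrow> agree (insert v (writes p)) s s' \<and> s' v 0 = int i \<and> Inv i s'" for i s'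
  have "runs b H (For v e p) s (J cnt)"
    unfolding For_def
  proof (rule runs_Seq)
    show "runs b H (Write v (Const 0) (Const 0)) s (J 0)"
      using start cnt by (intro runs_Write) (auto simp: J_def)
    fix s' assume "J 0 s'"
    then show "runs b H (WhilePos (Sub e (Var v)) (Seq p (Write v (Const 0) (Add (Var v) (Const 1))))) s' (J cnt)"
    proof (rule runs_WhilePos)
      show "cnt \<le> b" by (fact cnt)
      fix i s' assume i: "i < cnt" and J: "J i s'"
      have "runs b H (Seq p (Write v (Const 0) (Add (Var v) (Const 1)))) s' (J (Suc i))"
      proof (rule runs_Seq)
        show "runs b H p s' (\<lambda>s''. Inv (Suc i) (put v 0 (int i + 1) s''))"
          using step i J unfolding J_def by blast
        fix s'' assume "agree (writes p) s' s''" "Inv (Suc i) (put v 0 (int i + 1) s'')"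
        moreover from this J v have "s'' v 0 = int i" by (simp add: J_def)
        ultimately show "runs b H (Write v (Const 0) (Add (Var v) (Const 1))) s'' (J (Suc i))"
          using J i cnt by (intro runs_Write) (auto simp: J_def algebra_simps)
      qed
      moreover have "val e s' = int cnt" using J e unfolding J_def by blast
      ultimately show "val (Sub e (Var v)) s' > 0 \<and> runs b H (Seq p (Write v (Const 0) (Add (Var v) (Const 1)))) s' (J (Suc i))"
        using J i by (simp add: J_def)
    next
      fix s' assume "J cnt s'"
      then show "\<not> val (Sub e (Var v)) s' > 0" using e unfolding J_def by simp
    qed
  qed
  then show ?thesis by (rule runs_conseq) (simp add: J_def)
qed

definition Accumulate :: "string \<Rightarrow> string \<Rightarrow> expr \<Rightarrow> expr \<Rightarrow> program" where
  "Accumulate x v e f = For v e (Write x (Const 0) f)"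

lemma writes_Accumulate [simp]: "writes (Accumulate x v e f) = {v, x}"
  by (simp add: Accumulate_def)

lemma runs_Accumulate:
  assumes "cnt \<le> b" "int cnt \<le> H" "v \<noteq> x"
    and e: "\<And>s'. agree {v, x} s s' \<Longrightarrow> val e s' = int cnt"
    and start: "s x 0 = F 0"
    and step: "\<And>i s'. i < cnt \<Longrightarrow> agree {v, x} s s' \<Longrightarrow> s' v 0 = int i \<Longrightarrow> s' x 0 = F i \<Longrightarrow>
      val f s' = F (Suc i)"
    and bound: "\<And>i. i \<le> cnt \<Longrightarrow> \<bar>F i\<bar> \<le> H"
  shows "runs b H (Accumulate x v e f) s (\<lambda>s'. s' x 0 = F cnt)"
  unfolding Accumulate_def
  by (rule runs_For[where Inv = "\<lambda>i s'. s' x 0 = F i"])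
     (use assms in \<open>auto intro!: runs_Write e step\<close>)

definition Total :: "string \<Rightarrow> string \<Rightarrow> expr \<Rightarrow> expr \<Rightarrow> program" where
  "Total x v e f = Seq (Write x (Const 0) (Const 0)) (Accumulate x v e (Add (Var x) f))"

lemma writes_Total [simp]: "writes (Total x v e f) = {v, x}"
  by (auto simp: Total_def)

text \<open>Every partial sum is stored, and cancellation may make the final sum smaller than
  earlier ones; so all partial sums need the bound.\<close>

lemma runs_Total:
  assumes "cnt \<le> b" "int cnt \<le> H" "v \<noteq> x"
    and e: "\<And>s'. agree {v, x} s s' \<Longrightarrow> val e s' = int cnt"
    and step: "\<And>i s'. i < cnt \<Longrightarrow> agree {v, x} s s' \<Longrightarrow> s' v 0 = int i \<Longrightarrow> val f s' = g i"
    and bound: "\<And>l. l \<le> cnt \<Longrightarrow> \<bar>\<Sum>i<l. g i\<bar> \<le> H"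
  shows "runs b H (Total x v e f) s (\<lambda>s'. s' x 0 = (\<Sum>i<cnt. g i))"
  unfolding Total_def
proof (rule runs_Seq)
  show "runs b H (Write x (Const 0) (Const 0)) s (\<lambda>s'. s' x 0 = 0)"
    using bound[of 0] by (intro runs_Write) auto
  fix s' assume a: "agree (writes (Write x (Const 0) (Const 0))) s s'" and x: "s' x 0 = 0"
  show "runs b H (Accumulate x v e (Add (Var x) f)) s' (\<lambda>s'. s' x 0 = (\<Sum>i<cnt. g i))"
  proof (rule runs_Accumulate[where F = "\<lambda>l. \<Sum>i<l. g i"])
    fix s'' assume "agree {v, x} s' s''"
    then show "val e s'' = int cnt" using a by (intro e) auto
  next
    fix i s'' assume i: "i < cnt" and a': "agree {v, x} s' s''" "s'' v 0 = int i"
      and x: "s'' x 0 = (\<Sum>i<i. g i)"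
    have "val f s'' = g i" using a a' i by (intro step) auto
    then show "val (Add (Var x) f) s'' = (\<Sum>i<Suc i. g i)" using x by simp
  qed (use assms x in auto)
qed

text \<open>The offset \<open>k\<close> serves the output, where the set starts behind the kind in
  cell 0; all other arrays are filled from offset 0.\<close>

definition Fill :: "string \<Rightarrow> nat \<Rightarrow> string \<Rightarrow> expr \<Rightarrow> expr \<Rightarrow> program" where
  "Fill a k v e f = For v e (Write a (Add (Const (int k)) (Var v)) f)"

lemma writes_Fill [simp]: "writes (Fill a k v e f) = {v, a}"
  by (simp add: Fill_def)

lemma runs_Fill:
  assumes "cnt \<le> b" "int cnt \<le> H" "v \<noteq> a"
    and e: "\<And>s'. agree {v, a} s s' \<Longrightarrow> val e s' = int cnt"
    and step: "\<And>i s'. i < cnt \<Longrightarrow> agree {v, a} s s' \<Longrightarrow> s' v 0 = int i \<Longrightarrow> val f s' = G i"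
    and bound: "\<And>i. i < cnt \<Longrightarrow> \<bar>G i\<bar> \<le> H"
  shows "runs b H (Fill a k v e f) s (\<lambda>s'. (\<forall>i<cnt. s' a (int (k + i)) = G i) \<and>
    (\<forall>j. j < int k \<or> j \<ge> int (k + cnt) \<longrightarrow> s' a j = s a j))"
  unfolding Fill_def
proof (rule runs_conseq)
  let ?Inv = "\<lambda>l s'. \<forall>j. s' a j = (if int k \<le> j \<and> j < int (k + l) then G (nat (j - int k)) else s a j)"
  show "runs b H (For v e (Write a (Add (Const (int k)) (Var v)) f)) s (?Inv cnt)"
  proof (rule runs_For[where Inv = ?Inv])
    fix i s' assume i: "i < cnt" and ag: "agree (insert v (writes (Write a (Add (Const (int k)) (Var v)) f))) s s'"
      and v: "s' v 0 = int i" and I: "?Inv i s'"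
    have "val f s' = G i" using ag i v by (intro step) auto
    then show "runs b H (Write a (Add (Const (int k)) (Var v)) f) s' (\<lambda>s''. ?Inv (Suc i) (put v 0 (int i + 1) s''))"
      using i v I bound assms(3) by (intro runs_Write) auto
  qed (use assms in auto)
qed auto

section \<open>Polynomial bounds\<close>

lemma poly_bound_const: "\<exists>p :: nat poly. \<forall>x. c \<le> poly p x"
  by (rule exI[of _ "[:c:]"]) simp

lemma poly_bound_add:
  assumes "\<exists>p :: nat poly. \<forall>x. f x \<le> poly p x" "\<exists>p :: nat poly. \<forall>x. g x \<le> poly p x"
  shows "\<exists>p :: nat poly. \<forall>x. f x + g x \<le> poly p x"
  using assms by (metis add_mono poly_add)

lemma poly_bound_mult:
  assumes "\<exists>p :: nat poly. \<forall>x. f x \<le> poly p x" "\<exists>p :: nat poly. \<forall>x. g x \<le> poly p x"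
  shows "\<exists>p :: nat poly. \<forall>x. f x * g x \<le> poly p x"
  using assms by (metis mult_mono poly_mult zero_le)

text \<open>The program is fixed, so its nesting depth and the sizes of its expressions are
  constants; each loop contributes a factor \<open>b\<close>, each evaluation a factor
  \<open>W\<close>.\<close>

lemma poly_bound_time_bound:
  fixes q r :: "nat poly"
  shows "\<exists>p. \<forall>x. time_bound (poly q x) (poly r x) prog \<le> poly p x"
proof -
  have q: "\<exists>p. \<forall>x. poly q x \<le> poly p x" and r: "\<exists>p. \<forall>x. poly r x \<le> poly p x" by auto
  show ?thesis
  proof (induction prog)
    case (Write a e f)
    show ?case unfolding time_bound.simps
      by (intro poly_bound_add poly_bound_mult poly_bound_const r)
  next
    case (Seq p1 p2)
    show ?case unfolding time_bound.simps
      by (intro poly_bound_add poly_bound_const Seq)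
  next
    case (IfPos e p1 p2)
    show ?case unfolding time_bound.simps
      by (intro poly_bound_add poly_bound_mult poly_bound_const r IfPos)
  next
    case (WhilePos e p)
    show ?case unfolding time_bound.simps
      by (intro poly_bound_add poly_bound_mult poly_bound_const q r WhilePos)
  qed (use poly_bound_const[of 1] in simp)
qed

section \<open>Fraction-free Gauss--Jordan elimination\<close>

lemma abs_det_le_fact:
  fixes B :: "int mat"
  assumes B: "B \<in> carrier_mat k k" and b: "\<And>i l. i < k \<Longrightarrow> l < k \<Longrightarrow> \<bar>B $$ (i, l)\<bar> \<le> 1"
  shows "\<bar>det B\<bar> \<le> fact k"
proof -
  let ?P = "{p. p permutes {0..<k}}"
  have "\<bar>det B\<bar> \<le> (\<Sum>p\<in>?P. \<bar>of_int (sign p) * (\<Prod>i = 0..<k. B $$ (i, p i))\<bar>)"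
    unfolding det_def'[OF B] by (rule sum_abs)
  also have "\<dots> \<le> (\<Sum>p\<in>?P. 1)"
  proof (rule sum_mono)
    fix p assume "p \<in> ?P"
    then have "p i < k" if "i < k" for i using that permutes_in_image[of p "{0..<k}" i] by auto
    then have "(\<Prod>i = 0..<k. \<bar>B $$ (i, p i)\<bar>) \<le> 1" using b by (intro prod_le_1) auto
    then show "\<bar>of_int (sign p) * (\<Prod>i = 0..<k. B $$ (i, p i))\<bar> \<le> 1"
      by (simp add: abs_mult abs_prod sign_def)
  qed
  also have "\<dots> = fact k" by (simp add: card_permutations)
  finally show ?thesis .
qed

lemma abs_adj_mat_le_fact:
  fixes B :: "int mat"
  assumes B: "B \<in> carrier_mat k k" and b: "\<And>i l. i < k \<Longrightarrow> l < k \<Longrightarrow> \<bar>B $$ (i, l)\<bar> \<le> 1"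
    and "r < k" "l < k"
  shows "\<bar>adj_mat B $$ (r, l)\<bar> \<le> fact k"
proof -
  have "\<bar>det (mat_delete B l r)\<bar> \<le> fact (k - 1)"
    by (rule abs_det_le_fact[OF mat_delete_carrier[OF B]])
       (use B b assms(3,4) in \<open>auto simp: mat_delete_def\<close>)
  also have "\<dots> \<le> fact k" by (simp add: fact_mono)
  finally show ?thesis using assms by (simp add: adj_mat_def cofactor_def abs_mult power_abs)
qed

lemma adj_mat_sum:
  assumes B: "B \<in> carrier_mat k k" and "r < k" "l < k"
  shows "(\<Sum>i<k. adj_mat B $$ (r, i) * B $$ (i, l)) = (if r = l then det B else 0)"
proof -
  have "(\<Sum>i<k. adj_mat B $$ (r, i) * B $$ (i, l)) = (adj_mat B * B) $$ (r, l)"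
    using assms adj_mat(1)[OF B] by (simp add: times_mat_def scalar_prod_def lessThan_atLeast0)
  also have "\<dots> = (if r = l then det B else 0)" using adj_mat(3)[OF B] assms by simp
  finally show ?thesis .
qed

text \<open>Cramer's rule without division: the system is multiplied by the adjugate from the left,
  which stays inside the integers.\<close>

lemma adj_mat_solve:
  assumes B: "B \<in> carrier_mat k k" and r: "r < k"
    and z: "\<And>i. i < k \<Longrightarrow> (\<Sum>l<k. B $$ (i, l) * y l) = z i"
  shows "det B * y r = (\<Sum>i<k. adj_mat B $$ (r, i) * z i)"
proof -
  have "(\<Sum>i<k. adj_mat B $$ (r, i) * z i) = (\<Sum>i<k. \<Sum>l<k. adj_mat B $$ (r, i) * B $$ (i, l) * y l)"
    by (intro sum.cong) (simp_all add: z[symmetric] sum_distrib_left mult.assoc)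
  also have "\<dots> = (\<Sum>l<k. (\<Sum>i<k. adj_mat B $$ (r, i) * B $$ (i, l)) * y l)"
    by (subst sum.swap) (simp add: sum_distrib_right)
  also have "\<dots> = (\<Sum>l<k. if l = r then det B * y l else 0)"
    using adj_mat_sum[OF B r] by (intro sum.cong) auto
  also have "\<dots> = det B * y r" using r by simp
  finally show ?thesis ..
qed

text \<open>Laplace expansion along the replaced column: its cofactors do not see that column, so
  they are those of \<open>B\<close>. Through this identity a pivot entry becomes the determinant
  after the exchange of a column.\<close>

lemma det_replace_col:
  assumes B: "B \<in> carrier_mat k k" and r: "r < k"
  shows "det (mat k k (\<lambda>(i, l). if l = r then b i else B $$ (i, l))) = (\<Sum>i<k. adj_mat B $$ (r, i) * b i)"
proof -
  let ?R = "mat k k (\<lambda>(i, l). if l = r then b i else B $$ (i, l))"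
  have "det ?R = (\<Sum>i<k. ?R $$ (i, r) * cofactor ?R i r)"
    by (rule laplace_expansion_column) (use r in auto)
  also have "\<dots> = (\<Sum>i<k. adj_mat B $$ (r, i) * b i)"
  proof (rule sum.cong)
    fix i assume "i \<in> {..<k}"
    then have "mat_delete ?R i r = mat_delete B i r"
      using r B by (intro eq_matI) (auto simp: mat_delete_def)
    with \<open>i \<in> {..<k}\<close> show "?R $$ (i, r) * cofactor ?R i r = adj_mat B $$ (r, i) * b i"
      using r B by (simp add: adj_mat_def cofactor_def)
  qed simp
  finally show ?thesis .
qed

text \<open>
  \<open>M\<close> is \<open>D\<close> times the inverse of \<open>B\<close> times \<open>A\<close>, that is, \<open>M\<close> is the product of the adjugate of \<open>B\<close> and \<open>A\<close>.
  This is why the numbers arising in the elimination are integers of moderate size.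
\<close>

definition reduced :: "nat \<Rightarrow> nat \<Rightarrow> (nat \<Rightarrow> nat \<Rightarrow> int) \<Rightarrow> int mat \<Rightarrow> int \<Rightarrow> (nat \<Rightarrow> nat \<Rightarrow> int) \<Rightarrow> bool" where
  "reduced k n A B D M \<longleftrightarrow>
     B \<in> carrier_mat k k \<and> (\<forall>i<k. \<forall>l<k. \<bar>B $$ (i, l)\<bar> \<le> 1) \<and> det B = D \<and> D \<noteq> 0 \<and>
     (\<forall>i<k. \<forall>j<n. (\<Sum>l<k. B $$ (i, l) * M l j) = D * A i j)"

lemma reduced_init: "reduced k n A (1\<^sub>m k) 1 A"
  unfolding reduced_def by (auto simp: if_distrib[of "\<lambda>x. x * _"] cong: if_cong)

lemma reduced_adj_mat:
  assumes "reduced k n A B D M" "r < k" "j < n"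
  shows "M r j = (\<Sum>i<k. adj_mat B $$ (r, i) * A i j)"
proof -
  have B: "B \<in> carrier_mat k k" and D: "det B = D" "D \<noteq> 0" using assms(1) by (auto simp: reduced_def)
  have "det B * M r j = (\<Sum>i<k. adj_mat B $$ (r, i) * (D * A i j))"
    using assms by (intro adj_mat_solve[OF B]) (auto simp: reduced_def)
  also have "\<dots> = D * (\<Sum>i<k. adj_mat B $$ (r, i) * A i j)"
    by (simp add: sum_distrib_left ac_simps)
  finally show ?thesis using D by simp
qed

lemma reduced_bound:
  assumes red: "reduced k n A B D M" and "r < k" "j < n"
    and A: "\<And>i j. i < k \<Longrightarrow> j < n \<Longrightarrow> \<bar>A i j\<bar> \<le> 1"
  shows "\<bar>M r j\<bar> \<le> int k * fact k"
proof -
  have "\<bar>M r j\<bar> \<le> (\<Sum>i<k. \<bar>adj_mat B $$ (r, i) * A i j\<bar>)"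
    unfolding reduced_adj_mat[OF assms(1-3)] by (rule sum_abs)
  also have "\<dots> \<le> (\<Sum>i<k. fact k * 1)"
    unfolding abs_mult using assms
    by (intro sum_mono mult_mono abs_adj_mat_le_fact) (auto simp: reduced_def)
  finally show ?thesis by simp
qed

text \<open>Replacing column \<open>r\<close> of \<open>B\<close> by column \<open>c\<close> of
  \<open>A\<close> gives a matrix with determinant \<open>M r c\<close>, the new \<open>D\<close>.
  The numerators are the old \<open>D\<close> times the adjugate product for the new matrix, so the
  division leaves no remainder, as in Bareiss's method.\<close>

lemma reduced_pivot:
  fixes M :: "nat \<Rightarrow> nat \<Rightarrow> int"
  assumes red: "reduced k n A B D M" and r: "r < k" and c: "c < n" and nz: "M r c \<noteq> 0"
    and A: "\<And>i. i < k \<Longrightarrow> \<bar>A i c\<bar> \<le> 1"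
    and M': "\<And>i j. i < k \<Longrightarrow> j < n \<Longrightarrow>
      M' i j = (M r c * M i j - (M i c - (if i = r then D else 0)) * M r j) div D"
  shows "\<exists>B'. reduced k n A B' (M r c) M'"
    and "\<And>i j. i < k \<Longrightarrow> j < n \<Longrightarrow>
      D * M' i j = M r c * M i j - (M i c - (if i = r then D else 0)) * M r j"
proof -
  define N where "N i j = M r c * M i j - (M i c - (if i = r then D else 0)) * M r j" for i j
  define B' where "B' = mat k k (\<lambda>(i, l). if l = r then A i c else B $$ (i, l))"
  have B: "B \<in> carrier_mat k k" and D: "det B = D" "D \<noteq> 0"
    and BM: "\<And>i j. i < k \<Longrightarrow> j < n \<Longrightarrow> (\<Sum>l<k. B $$ (i, l) * M l j) = D * A i j"
    using red by (auto simp: reduced_def)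
  have B': "B' \<in> carrier_mat k k" by (simp add: B'_def)
  have det: "det B' = M r c"
    unfolding B'_def det_replace_col[OF B r] reduced_adj_mat[OF red r c] ..
  \<comment> \<open>Up to a correction in column \<open>r\<close>, \<open>B'\<close> acts like
    \<open>B\<close>, for which the products are known. Since \<open>N r j = D * M r j\<close>, the
    correction cancels both remaining terms that contain \<open>M r j\<close>.\<close>
  have key: "(\<Sum>l<k. B' $$ (i, l) * N l j) = D * (M r c * A i j)" if i: "i < k" and j: "j < n" for i j
  proof -
    have "(\<Sum>l<k. B' $$ (i, l) * N l j) =
        (\<Sum>l<k. B $$ (i, l) * N l j + (if l = r then (A i c - B $$ (i, r)) * N r j else 0))"
      using i by (intro sum.cong) (auto simp: B'_def algebra_simps)
    also have "\<dots> = (\<Sum>l<k. B $$ (i, l) * N l j) + (A i c - B $$ (i, r)) * N r j"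
      using r by (simp add: sum.distrib)
    also have "(\<Sum>l<k. B $$ (i, l) * N l j) =
        (\<Sum>l<k. M r c * (B $$ (i, l) * M l j) - M r j * (B $$ (i, l) * M l c)
          + (if l = r then B $$ (i, r) * D * M r j else 0))"
      by (intro sum.cong) (auto simp: N_def algebra_simps)
    also have "\<dots> = M r c * (D * A i j) - M r j * (D * A i c) + B $$ (i, r) * D * M r j"
      using r by (simp add: sum.distrib sum_subtractf sum_distrib_left[symmetric] BM i j c)
    also have "N r j = D * M r j" by (simp add: N_def algebra_simps)
    finally show ?thesis by (simp add: algebra_simps)
  qed
  \<comment> \<open>\<open>det B' = M r c\<close> is a nonzero factor of both sides; cancelling it
    exhibits \<open>N i j\<close> as a multiple of \<open>D\<close>.\<close>
  have exact: "D * M' i j = N i j" if i: "i < k" and j: "j < n" for i j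
  proof -
    have "det B' * N i j = (\<Sum>l<k. adj_mat B' $$ (i, l) * (D * (M r c * A l j)))"
      using key j by (intro adj_mat_solve[OF B' i]) auto
    also have "\<dots> = M r c * (D * (\<Sum>l<k. adj_mat B' $$ (i, l) * A l j))"
      by (simp add: sum_distrib_left ac_simps)
    finally have "N i j = D * (\<Sum>l<k. adj_mat B' $$ (i, l) * A l j)" using det nz by simp
    moreover have "M' i j = N i j div D" using M'[OF i j] by (simp add: N_def)
    ultimately show ?thesis using D by simp
  qed
  then show "D * M' i j = M r c * M i j - (M i c - (if i = r then D else 0)) * M r j"
    if "i < k" "j < n" for i j using that by (simp add: N_def)
  have "(\<Sum>l<k. B' $$ (i, l) * M' l j) = M r c * A i j" if i: "i < k" and j: "j < n" for i j
  proof -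
    have "D * (\<Sum>l<k. B' $$ (i, l) * M' l j) = (\<Sum>l<k. B' $$ (i, l) * N l j)"
      unfolding sum_distrib_left using j
      by (intro sum.cong) (auto simp: exact[symmetric])
    then show ?thesis using key[OF i j] D by simp
  qed
  moreover have "\<forall>i<k. \<forall>l<k. \<bar>B' $$ (i, l)\<bar> \<le> 1"
    using red A by (auto simp: B'_def reduced_def)
  ultimately have "reduced k n A B' (M r c) M'"
    unfolding reduced_def using B' det nz by blast
  then show "\<exists>B'. reduced k n A B' (M r c) M'" ..
qed

text \<open>A zero row of \<open>M\<close> would make row \<open>r\<close> of the adjugate a linear
  dependency of the rows of \<open>A\<close>, hence zero, although its product with column
  \<open>r\<close> of \<open>B\<close> is \<open>D\<close>. So every row offers a pivot, and rows
  are never exchanged.\<close>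

lemma reduced_row_nonzero:
  assumes red: "reduced k n A B D M" and r: "r < k"
    and indep: "\<And>y :: nat \<Rightarrow> int. (\<And>j. j < n \<Longrightarrow> (\<Sum>i<k. y i * A i j) = 0) \<Longrightarrow> \<forall>i<k. y i = 0"
  shows "\<exists>c<n. M r c \<noteq> 0"
proof (rule ccontr)
  assume "\<not> (\<exists>c<n. M r c \<noteq> 0)"
  then have "\<forall>i<k. adj_mat B $$ (r, i) = 0"
    using reduced_adj_mat[OF red r] by (intro indep) auto
  then have "(\<Sum>i<k. adj_mat B $$ (r, i) * B $$ (i, r)) = 0" by simp
  with adj_mat_sum[of B k r r] r red show False by (simp add: reduced_def)
qed

definition pivots :: "nat \<Rightarrow> nat \<Rightarrow> nat \<Rightarrow> (nat \<Rightarrow> nat) \<Rightarrow> int \<Rightarrow> (nat \<Rightarrow> nat \<Rightarrow> int) \<Rightarrow> bool" where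
  "pivots r k n C D M \<longleftrightarrow>
     (\<forall>l<r. C l < n \<and> (\<forall>i<k. M i (C l) = (if i = l then D else 0)))"

text \<open>Earlier pivot columns vanish in row \<open>r\<close>, so the step merely rescales them
  from the old \<open>D\<close> to the new one. In column \<open>c\<close> the two products cancel
  except for the correction in row \<open>r\<close>.\<close>

lemma pivots_step:
  assumes piv: "pivots r k n C D M" and r: "r < k" and c: "c < n" and "D \<noteq> 0"
    and M': "\<And>i j. i < k \<Longrightarrow> j < n \<Longrightarrow>
      D * M' i j = M r c * M i j - (M i c - (if i = r then D else 0)) * M r j"
  shows "pivots (Suc r) k n (C(r := c)) (M r c) M'"
  unfolding pivots_def
proof (intro allI impI conjI)
  fix l assume l: "l < Suc r"
  then show cl: "(C(r := c)) l < n" using piv c by (auto simp: pivots_def)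
  fix i assume i: "i < k"
  have "D * M' i ((C(r := c)) l) = D * (if i = l then M r c else 0)"
  proof (cases "l = r")
    case True
    then show ?thesis using M'[OF i c] by (auto simp: algebra_simps)
  next
    case False
    with l have "l < r" by simp
    with piv r i have "M i (C l) = (if i = l then D else 0)" "M r (C l) = 0" "C l < n"
      by (auto simp: pivots_def)
    then show ?thesis using False M'[OF i, of "C l"] by simp
  qed
  then show "M' i ((C(r := c)) l) = (if i = l then M r c else 0)" using \<open>D \<noteq> 0\<close> by simp
qed

section \<open>Spans and independence of characteristic vectors\<close>

lemma sum_fun_apply: "sum F S j = (\<Sum>a\<in>S. F a j)" for F :: "'a \<Rightarrow> 'b \<Rightarrow> 'c :: comm_monoid_add"
  by (induction S rule: infinite_finite_induct) auto

lemma inj_char_vec: "inj (char_vec :: nat set \<Rightarrow> nat \<Rightarrow> real)"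
proof (rule injI)
  fix S T :: "nat set" assume "char_vec S = (char_vec T :: nat \<Rightarrow> real)"
  then have "char_vec S i = (char_vec T i :: real)" for i by (rule fun_cong)
  then have "i \<in> S \<longleftrightarrow> i \<in> T" for i by (metis indicator_simps zero_neq_one)
  then show "S = T" by blast
qed

lemma inj_on_char_vec_nth:
  assumes "distinct Ss"
  shows "inj_on (\<lambda>l. char_vec (Ss ! l) :: nat \<Rightarrow> real) {..<length Ss}"
proof (rule inj_onI)
  fix x y assume "x \<in> {..<length Ss}" "y \<in> {..<length Ss}"
    "char_vec (Ss ! x) = (char_vec (Ss ! y) :: nat \<Rightarrow> real)"
  then show "x = y" using assms injD[OF inj_char_vec, of "Ss ! x" "Ss ! y"]
    by (simp add: nth_eq_iff_index_eq)
qed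

lemma sum_char_vec_nth:
  assumes "distinct Ss"
  shows "(\<Sum>f\<in>char_vec ` set Ss. g f) = (\<Sum>l<length Ss. g (char_vec (Ss ! l) :: nat \<Rightarrow> real))"
proof -
  have "bij_betw (\<lambda>l. char_vec (Ss ! l) :: nat \<Rightarrow> real) {..<length Ss} (char_vec ` set Ss)"
    unfolding bij_betw_def using inj_on_char_vec_nth[OF assms] by (auto simp: set_conv_nth)
  from sum.reindex_bij_betw[OF this, of g] show ?thesis ..
qed

lemma span_char_vec_iff:
  assumes "distinct Ss"
  shows "f \<in> coord.span (char_vec ` set Ss) \<longleftrightarrow>
    (\<exists>y. \<forall>j. f j = (\<Sum>l<length Ss. y l * char_vec (Ss ! l) j))"
proof
  assume "f \<in> coord.span (char_vec ` set Ss)"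
  then obtain u where "f = (\<Sum>v\<in>char_vec ` set Ss. (\<lambda>i. u v * v i))"
    by (auto simp: coord.span_finite)
  then have "\<forall>j. f j = (\<Sum>l<length Ss. u (char_vec (Ss ! l)) * char_vec (Ss ! l) j)"
    by (simp add: sum_fun_apply sum_char_vec_nth[OF assms])
  then show "\<exists>y. \<forall>j. f j = (\<Sum>l<length Ss. y l * char_vec (Ss ! l) j)"
    by (intro exI[of _ "\<lambda>l. u (char_vec (Ss ! l))"])
next
  assume "\<exists>y. \<forall>j. f j = (\<Sum>l<length Ss. y l * char_vec (Ss ! l) j)"
  then obtain y where y: "\<And>j. f j = (\<Sum>l<length Ss. y l * char_vec (Ss ! l) j)" by blast
  have "f = (\<Sum>l<length Ss. (\<lambda>i. y l * char_vec (Ss ! l) i))"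
    by (rule ext) (simp add: y sum_fun_apply)
  also have "\<dots> \<in> coord.span (char_vec ` set Ss)"
    by (intro coord.span_sum coord.span_scale coord.span_base) auto
  finally show "f \<in> coord.span (char_vec ` set Ss)" .
qed

text \<open>Carries real independence of vectors over to integer combinations of the 0/1 rows,
  looking at columns below \<open>n\<close> only; beyond them all members of the family
  vanish.\<close>

lemma independent_family_rows:
  assumes ind: "independent_family Ss" and sub: "\<forall>S\<in>set Ss. S \<subseteq> {..<n}"
    and z: "\<And>j. j < n \<Longrightarrow> (\<Sum>i<length Ss. y i * of_bool (j \<in> Ss ! i)) = (0 :: int)"
  shows "\<forall>i<length Ss. y i = 0"
proof (intro allI impI)
  fix i assume i: "i < length Ss"
  have d: "distinct Ss" using ind by (simp add: independent_family_def)
  note inj = inj_on_char_vec_nth[OF d]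
  \<comment> \<open>\<open>coord.independent\<close> speaks of coefficients attached to vectors, so
    the list position of a vector is recovered by inverting the injective indexing.\<close>
  define u where "u v = real_of_int (y (the_inv_into {..<length Ss} (\<lambda>l. char_vec (Ss ! l)) v))"
    for v :: "nat \<Rightarrow> real"
  have u: "u (char_vec (Ss ! l)) = y l" if "l < length Ss" for l
    unfolding u_def using the_inv_into_f_f[OF inj] that by simp
  have "(\<Sum>v\<in>char_vec ` set Ss. (\<lambda>i. u v * v i)) = 0"
  proof
    fix j
    have "(\<Sum>v\<in>char_vec ` set Ss. (\<lambda>i. u v * v i)) j = (\<Sum>l<length Ss. u (char_vec (Ss ! l)) * char_vec (Ss ! l) j)"
      by (simp add: sum_fun_apply sum_char_vec_nth[OF d])
    also have "\<dots> = real_of_int (\<Sum>l<length Ss. y l * of_bool (j \<in> Ss ! l))"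
      unfolding of_int_sum by (intro sum.cong) (auto simp: u indicator_def)
    also have "(\<Sum>l<length Ss. y l * of_bool (j \<in> Ss ! l)) = 0"
    proof (cases "j < n")
      case False
      then have "j \<notin> Ss ! l" if "l < length Ss" for l using that sub nth_mem by blast
      then show ?thesis by simp
    qed (fact z)
    finally show "(\<Sum>v\<in>char_vec ` set Ss. (\<lambda>i. u v * v i)) j = 0 j" by simp
  qed
  moreover have "coord.independent (char_vec ` set Ss)" using ind by (simp add: independent_family_def)
  ultimately have "u (char_vec (Ss ! i)) = 0"
    using i by (intro coord.independentD[of "char_vec ` set Ss" "char_vec ` set Ss"]) auto
  then show "y i = 0" using u[OF i] by simp
qed

text \<open>The rows of \<open>M\<close> span the same space as the family, and on the pivot columns
  they form \<open>D\<close> times the identity. So the entries of \<open>S\<close> at the pivot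
  columns dictate the only possible coefficients, and these have to be tested in every
  column.\<close>

lemma reduced_span_iff:
  assumes red: "reduced (length Ss) n (\<lambda>l j. of_bool (j \<in> Ss ! l)) B D M"
    and piv: "pivots (length Ss) (length Ss) n C D M"
    and d: "distinct Ss" and sub: "\<forall>S\<in>set Ss. S \<subseteq> {..<n}" and S: "S \<subseteq> {..<n}"
  shows "char_vec S \<in> coord.span (char_vec ` set Ss) \<longleftrightarrow>
    (\<forall>j<n. (\<Sum>r<length Ss. of_bool (C r \<in> S) * M r j) = D * of_bool (j \<in> S))"
proof -
  let ?k = "length Ss"
  have D: "D \<noteq> 0" and BM: "\<And>i j. i < ?k \<Longrightarrow> j < n \<Longrightarrow>
    (\<Sum>l<?k. B $$ (i, l) * M l j) = D * of_bool (j \<in> Ss ! i)"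
    using red by (auto simp: reduced_def)
  have char: "char_vec T j = real_of_int (of_bool (j \<in> T))" for T and j :: nat
    by (simp add: indicator_def)
  show ?thesis unfolding span_char_vec_iff[OF d]
  proof
    assume "\<exists>y. \<forall>j. char_vec S j = (\<Sum>l<?k. y l * char_vec (Ss ! l) j)"
    then obtain y :: "nat \<Rightarrow> real"
      where y: "\<And>j. char_vec S j = (\<Sum>l<?k. y l * char_vec (Ss ! l) j)" by blast
    define z where "z l = (\<Sum>i<?k. y i * of_int (B $$ (i, l)))" for l
    have DS: "D * char_vec S j = (\<Sum>l<?k. z l * M l j)" if j: "j < n" for j
    proof -
      have "D * char_vec S j = (\<Sum>i<?k. y i * of_int (D * of_bool (j \<in> Ss ! i)))"
        unfolding y sum_distrib_left by (intro sum.cong) (auto simp: indicator_def)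
      also have "\<dots> = (\<Sum>i<?k. \<Sum>l<?k. y i * of_int (B $$ (i, l)) * M l j)"
        using BM j by (intro sum.cong) (auto simp: sum_distrib_left mult.assoc simp flip: BM)
      also have "\<dots> = (\<Sum>l<?k. z l * M l j)"
        unfolding z_def by (subst sum.swap) (simp add: sum_distrib_right)
      finally show ?thesis .
    qed
    have z: "z r = of_bool (C r \<in> S)" if r: "r < ?k" for r
    proof -
      have "D * char_vec S (C r) = (\<Sum>l<?k. z l * M l (C r))"
        using DS piv r by (simp add: pivots_def)
      also have "\<dots> = (\<Sum>l<?k. if l = r then z l * D else 0)"
        using piv r by (intro sum.cong) (auto simp: pivots_def)
      also have "\<dots> = z r * D" using r by simp
      finally show ?thesis using D by (simp add: indicator_def)
    qed
    show "\<forall>j<n. (\<Sum>r<?k. of_bool (C r \<in> S) * M r j) = D * of_bool (j \<in> S)"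
    proof (intro allI impI)
      fix j assume "j < n"
      from DS[OF this] have "real_of_int (D * of_bool (j \<in> S)) = of_int (\<Sum>r<?k. of_bool (C r \<in> S) * M r j)"
        by (simp add: char z)
      then show "(\<Sum>r<?k. of_bool (C r \<in> S) * M r j) = D * of_bool (j \<in> S)" by linarith
    qed
  next
    assume *: "\<forall>j<n. (\<Sum>r<?k. of_bool (C r \<in> S) * M r j) = D * of_bool (j \<in> S)"
    define y where "y l = real_of_int (\<Sum>r<?k. of_bool (C r \<in> S) * adj_mat B $$ (r, l)) / D" for l
    have "char_vec S j = (\<Sum>l<?k. y l * char_vec (Ss ! l) j)" for j
    proof (cases "j < n")
      case False
      then have "j \<notin> S" "\<And>l. l < ?k \<Longrightarrow> j \<notin> Ss ! l" using S sub nth_mem by blast+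
      then show ?thesis by simp
    next
      case True
      have "D * of_bool (j \<in> S) = (\<Sum>r<?k. of_bool (C r \<in> S) * M r j)" using * True by simp
      also have "\<dots> = (\<Sum>r<?k. \<Sum>l<?k. of_bool (C r \<in> S) * adj_mat B $$ (r, l) * of_bool (j \<in> Ss ! l))"
        using True by (intro sum.cong) (auto simp: reduced_adj_mat[OF red] sum_distrib_left mult.assoc)
      also have "\<dots> = (\<Sum>l<?k. (\<Sum>r<?k. of_bool (C r \<in> S) * adj_mat B $$ (r, l)) * of_bool (j \<in> Ss ! l))"
        by (subst sum.swap) (simp only: sum_distrib_right)
      finally have "real_of_int (D * of_bool (j \<in> S)) = of_int \<dots>" by simp
      also have "\<dots> = (\<Sum>l<?k. D * y l * char_vec (Ss ! l) j)"
        unfolding of_int_sum of_int_mult using D by (intro sum.cong) (auto simp: y_def char)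
      finally have "D * char_vec S j = D * (\<Sum>l<?k. y l * char_vec (Ss ! l) j)"
        by (simp only: char of_int_mult sum_distrib_left mult.assoc)
      then show ?thesis using D by simp
    qed
    then show "\<exists>y. \<forall>j. char_vec S j = (\<Sum>l<?k. y l * char_vec (Ss ! l) j)" by blast
  qed
qed

section \<open>Reduction to polynomially many coalitions\<close>

text \<open>\<open>f\<close> is the exchanged player, and \<open>f = n\<close> encodes that nobody
  is exchanged. Players in \<open>K\<close> stay even if \<open>f\<close> names them.\<close>

definition candidate :: "nat \<Rightarrow> nat set \<Rightarrow> (nat \<Rightarrow> 'a :: linordered_idom) \<Rightarrow> nat \<Rightarrow> nat set" where
  "candidate n K w f = {i. i < n \<and> (i \<in> K \<or> (w i < 0 \<longleftrightarrow> i \<noteq> f))}"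

lemma sum_eq_sum_of_bool:
  fixes w :: "nat \<Rightarrow> 'a :: linordered_idom"
  assumes "S \<subseteq> {..<n}"
  shows "(\<Sum>i\<in>S. w i) = (\<Sum>i<n. of_bool (i \<in> S) * w i)"
proof -
  have "(\<Sum>i<n. of_bool (i \<in> S) * w i) = (\<Sum>i\<in>{..<n} \<inter> S. w i)"
    by (simp add: sum.inter_restrict[symmetric] of_bool_def if_distrib[of "\<lambda>x. x * _"] cong: if_cong)
  then show ?thesis using assms by (simp add: Int_absorb1)
qed

lemma char_vec_update:
  assumes "S \<subseteq> {..<n}" "T \<subseteq> {..<n}"
  shows "char_vec S = char_vec T + (\<Sum>i<n. (\<lambda>j. (char_vec S i - char_vec T i) * char_vec {i} j))"
proof
  fix j
  have "(\<Sum>i<n. (char_vec S i - char_vec T i) * char_vec {i} j) =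
      (\<Sum>i<n. if i = j then char_vec S j - char_vec T j else 0)"
    by (intro sum.cong) (auto simp: indicator_def)
  also have "\<dots> = char_vec S j - char_vec T j"
    using assms by (auto simp: indicator_def)
  finally show "char_vec S j = (char_vec T + (\<Sum>i<n. (\<lambda>j. (char_vec S i - char_vec T i) * char_vec {i} j))) j"
    by (simp add: sum_fun_apply)
qed

text \<open>
  Without the condition on the span, the best coalition containing \<open>K\<close> adds exactly the players of
  negative weight. If it lies in the span, then it differs from \<open>S\<close> in a player whose unit vector
  does not, and it suffices to exchange this single player.
\<close>

lemma candidate_optimal:
  fixes w :: "nat \<Rightarrow> 'a :: linordered_idom"
  assumes S: "S \<subseteq> {..<n}" "K \<subseteq> S" and out: "char_vec S \<notin> coord.span X"
  shows "\<exists>f\<le>n. char_vec (candidate n K w f) \<notin> coord.span X \<and>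
    (\<Sum>i\<in>candidate n K w f. w i) \<le> (\<Sum>i\<in>S. w i)"
proof -
  have sub: "candidate n K w f \<subseteq> {..<n}" for f by (auto simp: candidate_def)
  \<comment> \<open>Termwise comparison: outside \<open>K\<close>, an unexchanged player contributes
    the smaller of 0 and \<open>w i\<close>, and an exchanged one contributes what it does in
    \<open>S\<close>.\<close>
  have le: "(\<Sum>i\<in>candidate n K w f. w i) \<le> (\<Sum>i\<in>S. w i)"
    if "f < n \<Longrightarrow> f \<in> candidate n K w f \<longleftrightarrow> f \<in> S" for f
    unfolding sum_eq_sum_of_bool[OF S(1)] sum_eq_sum_of_bool[OF sub]
  proof (rule sum_mono)
    fix i assume "i \<in> {..<n}"
    then show "of_bool (i \<in> candidate n K w f) * w i \<le> of_bool (i \<in> S) * w i"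
      using that S(2) by (cases "i = f") (auto simp: candidate_def)
  qed
  show ?thesis
  proof (cases "char_vec (candidate n K w n) \<in> coord.span X")
    case False
    then show ?thesis using le[of n] by auto
  next
    case True
    let ?T = "candidate n K w n"
    have "\<exists>i<n. (char_vec S i :: real) \<noteq> char_vec ?T i \<and> char_vec {i} \<notin> coord.span X"
    proof (rule ccontr)
      assume *: "\<not> ?thesis"
      have "(\<lambda>j. (char_vec S i - char_vec ?T i) * char_vec {i} j) \<in> coord.span X" if "i < n" for i
      proof (cases "char_vec S i = (char_vec ?T i :: real)")
        case eq: True
        have "(\<lambda>j. (char_vec S i - char_vec ?T i) * char_vec {i} j) = (0 :: nat \<Rightarrow> real)"
          by (rule ext) (simp add: eq)
        then show ?thesis by (simp only: coord.span_zero)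
      next
        case False
        with * that have "char_vec {i} \<in> coord.span X" by blast
        then show ?thesis by (rule coord.span_scale)
      qed
      then have "char_vec S \<in> coord.span X"
        by (subst char_vec_update[OF S(1) sub[of n]]) (intro coord.span_add coord.span_sum True; simp)
      with out show False ..
    qed
    then obtain i where i: "i < n" and ST: "i \<in> S \<longleftrightarrow> i \<notin> ?T" and ei: "char_vec {i} \<notin> coord.span X"
      by (metis indicator_simps)
    \<comment> \<open>\<open>S\<close> and \<open>?T\<close> agree on \<open>K\<close>, so
      \<open>i\<close> is not in \<open>K\<close> and the exchange takes effect.\<close>
    have iT: "i \<in> candidate n K w i \<longleftrightarrow> i \<in> S" using ST i S(2) by (auto simp: candidate_def)
    have other: "j \<in> candidate n K w i \<longleftrightarrow> j \<in> ?T" if "j \<noteq> i" for j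
      using that by (auto simp: candidate_def)
    have "char_vec (candidate n K w i) \<notin> coord.span X"
    proof
      assume in_span: "char_vec (candidate n K w i) \<in> coord.span X"
      define c :: real where "c = (if i \<in> S then 1 else -1)"
      have "char_vec {i} = (\<lambda>j. c * (char_vec (candidate n K w i) - char_vec ?T) j)"
      proof
        fix j show "char_vec {i} j = c * (char_vec (candidate n K w i) - char_vec ?T) j"
          using ST iT other by (cases "j = i") (auto simp: c_def indicator_def)
      qed
      also have "\<dots> \<in> coord.span X" by (intro coord.span_scale coord.span_diff in_span True)
      finally show False using ei by contradiction
    qed
    then show ?thesis using le[OF iT] i by (intro exI[of _ i]) auto
  qed
qed

section \<open>A linear upper bound on the excess\<close>

definition weight ::
    "nat \<Rightarrow> (nat \<Rightarrow> nat \<Rightarrow> 'a :: comm_ring_1) \<Rightarrow> (nat \<Rightarrow> nat \<Rightarrow> 'a) \<Rightarrow> (nat \<Rightarrow> 'a) \<Rightarrow> (nat \<Rightarrow> nat) \<Rightarrow> nat \<Rightarrow> 'a"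
  where "weight m \<alpha> d x K i = x i - (\<Sum>j<m. d i j * \<alpha> (K j) j)"

lemma sum_weight:
  "(\<Sum>i\<in>S. weight m \<alpha> d x K i) = (\<Sum>i\<in>S. x i) - (\<Sum>j<m. (\<Sum>i\<in>S. d i j) * \<alpha> (K j) j)"
  unfolding weight_def sum_subtractf sum_distrib_right by (subst sum.swap) simp

text \<open>Demands are nonnegative, so lowering each maximum to the profit of some member can only
  raise the difference.\<close>

lemma excess_le_weight:
  assumes "S \<noteq> {}" "finite S" "\<And>j. j < m \<Longrightarrow> K j \<in> S" "\<And>i j. i \<in> S \<Longrightarrow> j < m \<Longrightarrow> 0 \<le> d i j"
  shows "(\<Sum>i\<in>S. x i) - game_value m \<alpha> d S \<le> (\<Sum>i\<in>S. weight m \<alpha> d x K i)"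
proof -
  have "(\<Sum>j<m. (\<Sum>i\<in>S. d i j) * \<alpha> (K j) j) \<le> (\<Sum>j<m. (\<Sum>i\<in>S. d i j) * Max ((\<lambda>k. \<alpha> k j) ` S))"
    using assms by (intro sum_mono mult_left_mono Max_ge sum_nonneg) auto
  then show ?thesis using assms(1) by (simp add: sum_weight game_value_def)
qed

lemma excess_eq_weight:
  assumes "S \<noteq> {}" "finite S"
  shows "\<exists>K. (\<forall>j. K j \<in> S) \<and> (\<Sum>i\<in>S. weight m \<alpha> d x K i) = (\<Sum>i\<in>S. x i) - game_value m \<alpha> d S"
proof -
  have "\<exists>k. k \<in> S \<and> \<alpha> k j = Max ((\<lambda>k. \<alpha> k j) ` S)" for j
  proof -
    have "Max ((\<lambda>k. \<alpha> k j) ` S) \<in> (\<lambda>k. \<alpha> k j) ` S" using assms by (intro Max_in) auto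
    then show ?thesis by auto
  qed
  then obtain K where "\<And>j. K j \<in> S" "\<And>j. \<alpha> (K j) j = Max ((\<lambda>k. \<alpha> k j) ` S)" by metis
  then show ?thesis using assms by (intro exI[of _ K]) (simp add: sum_weight game_value_def)
qed

text \<open>A number below \<open>n ^ m\<close> encodes a choice of \<open>m\<close> players by its digits in base \<open>n\<close>.\<close>

definition digit :: "nat \<Rightarrow> nat \<Rightarrow> nat \<Rightarrow> nat" where
  "digit n u j = u div n ^ j mod n"

lemma digit_less: "0 < n \<Longrightarrow> digit n u j < n"
  by (simp add: digit_def)

lemma digits_surj:
  assumes "\<And>j. j < m \<Longrightarrow> K j < n"
  shows "\<exists>u<n ^ m. \<forall>j<m. digit n u j = K j"
  using assms
proof (induction m)
  case (Suc m)
  then obtain u where u: "u < n ^ m" "\<forall>j<m. digit n u j = K j" by auto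
  have n: "0 < n" using Suc.prems[of m] by simp
  let ?v = "u + K m * n ^ m"
  have "Suc (K m) * n ^ m \<le> n * n ^ m" using Suc.prems[of m] by (intro mult_right_mono) auto
  then have "?v < n ^ Suc m" using u(1) by simp
  moreover have "digit n ?v j = K j" if "j < Suc m" for j
  proof (cases "j = m")
    case True
    then show ?thesis using u(1) n Suc.prems[of m] by (simp add: digit_def)
  next
    case False
    with that have j: "j < m" by simp
    \<comment> \<open>The new leading term is a multiple of \<open>n ^ Suc j\<close>, so after
      division by \<open>n ^ j\<close> it vanishes modulo \<open>n\<close>.\<close>
    then have "n ^ m = n ^ j * (n * n ^ (m - Suc j))"
      by (simp flip: power_add power_Suc)
    then have "?v = u + n ^ j * (n * (K m * n ^ (m - Suc j)))" by (simp add: ac_simps)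
    then have "?v div n ^ j = n * (K m * n ^ (m - Suc j)) + u div n ^ j"
      using n by (simp only: div_mult_self2) simp
    then have "digit n ?v j = digit n u j" by (simp add: digit_def)
    then show ?thesis using u(2) j by simp
  qed
  ultimately show ?case by blast
qed auto

section \<open>The input\<close>

lemma concat_map_nth:
  assumes "\<And>i. i < N \<Longrightarrow> length (f i) = q" "i < N" "r < q"
  shows "concat (map f [0..<N]) ! (i * q + r) = f i ! r"
proof -
  have len: "length (concat (map f [0..<M])) = M * q" if "M \<le> N" for M
    using that assms(1) by (induction M) auto
  show ?thesis using assms
  proof (induction N)
    case (Suc N)
    have lenN: "length (concat (map f [0..<N])) = N * q"
      using Suc.prems(1) by (induction N) auto
    show ?case
    proof (cases "i = N")
      case True
      then show ?thesis using lenN Suc.prems by (simp add: nth_append)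
    next
      case False
      then have i: "i < N" using Suc by simp
      have "Suc i * q \<le> N * q" using i by (intro mult_right_mono) auto
      then have "i * q + r < N * q" using Suc.prems by simp
      then show ?thesis using lenN Suc i by (simp add: nth_append)
    qed
  qed simp
qed

lemma concat_map_length:
  "(\<And>i. i < N \<Longrightarrow> length (f i) = q) \<Longrightarrow> length (concat (map f [0..<N])) = N * q"
  by (induction N) auto

section \<open>Layout of the encoded instance\<close>

locale sep_problem =
  fixes m :: nat and I :: sep_instance
  assumes valid: "valid_instance m I"
begin

definition n where "n = players I"
definition k where "k = length (family I)"
definition zs where "zs = enc_instance m I"
definition L where "L = encoding_length zs"

definition profit_pos where "profit_pos i j = 2 + 2 * (i * m + j)"
definition demand_pos where "demand_pos i j = 2 + 2 * (n * m) + 2 * (i * m + j)"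
definition family_pos where "family_pos l i = 2 + 4 * (n * m) + l * n + i"
definition fixed_pos where "fixed_pos l = 2 + 4 * (n * m) + k * n + 2 * l"
definition point_pos where "point_pos i = 2 + 4 * (n * m) + k * n + 2 * k + 2 * i"
definition level_pos where "level_pos = 2 + 4 * (n * m) + k * n + 2 * k + 2 * n"

definition rat_at :: "rat \<Rightarrow> nat \<Rightarrow> bool" where
  "rat_at q a \<longleftrightarrow> Suc a < length zs \<and> zs ! a = fst (quotient_of q) \<and> zs ! Suc a = snd (quotient_of q)"

lemma n_pos: "0 < n" and k_le: "k \<le> n"
  using valid by (auto simp: valid_instance_def n_def k_def)

lemma length_enc_rat [simp]: "length (enc_rat q) = 2"
  by (simp add: enc_rat_def)

lemma length_enc_set [simp]: "length (enc_set N S) = N"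
  by (simp add: enc_set_def)

lemma matrix_pos_less: "i < N \<Longrightarrow> j < (M :: nat) \<Longrightarrow> i * M + j < N * M"
proof -
  assume "i < N" "j < M"
  then have "Suc i * M \<le> N * M" by (intro mult_right_mono) auto
  with \<open>j < M\<close> show ?thesis by simp
qed

lemma length_enc_matrix: "length (enc_matrix N M A) = 2 * (N * M)"
proof -
  have "length (concat (map (\<lambda>j. enc_rat (A i j)) [0..<M])) = M * 2" for i
    by (rule concat_map_length) simp
  then have "length (enc_matrix N M A) = N * (M * 2)"
    unfolding enc_matrix_def by (intro concat_map_length) simp
  then show ?thesis by simp
qed

lemma nth_enc_matrix:
  assumes "i < N" "j < M" "r < 2"
  shows "enc_matrix N M A ! (2 * (i * M + j) + r) = enc_rat (A i j) ! r"
proof -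
  have len: "length (concat (map (\<lambda>j. enc_rat (A i j)) [0..<M])) = M * 2" for i
    by (rule concat_map_length) simp
  have "j * 2 + r < M * 2" using matrix_pos_less[OF assms(2,3)] .
  then have "enc_matrix N M A ! (i * (M * 2) + (j * 2 + r)) =
      concat (map (\<lambda>j. enc_rat (A i j)) [0..<M]) ! (j * 2 + r)"
    unfolding enc_matrix_def using len assms by (intro concat_map_nth) auto
  also have "\<dots> = enc_rat (A i j) ! r" using assms by (intro concat_map_nth) auto
  finally show ?thesis by (simp add: algebra_simps)
qed

lemma map_family: "map g (family I) = map (\<lambda>l. g (family I ! l)) [0..<k]"
  by (rule nth_equalityI) (auto simp: k_def)

lemma length_sets: "length (concat (map (enc_set n) (family I))) = k * n"
  unfolding map_family by (intro concat_map_length) simp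

lemma length_fixed: "length (concat (map (\<lambda>S. enc_rat (fixed I S)) (family I))) = k * 2"
  unfolding map_family by (intro concat_map_length) simp

lemma length_point: "length (concat (map (\<lambda>i. enc_rat (point I i)) [0..<n])) = n * 2"
  by (intro concat_map_length) simp

lemma zs_eq: "zs = [int n, int k] @ enc_matrix n m (profit I) @ enc_matrix n m (demand I) @
    concat (map (enc_set n) (family I)) @ concat (map (\<lambda>S. enc_rat (fixed I S)) (family I)) @
    concat (map (\<lambda>i. enc_rat (point I i)) [0..<n]) @ enc_rat (level I)"
  by (simp add: zs_def enc_instance_def n_def k_def)

lemma length_zs: "length zs = 2 + 4 * (n * m) + k * n + 2 * k + 2 * n + 2"
  by (simp add: zs_eq length_enc_matrix length_sets length_fixed length_point)

lemma zs_0: "zs ! 0 = int n" and zs_1: "zs ! Suc 0 = int k"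
  by (simp_all add: zs_eq)

lemma nth_append_offset: "length xs = N \<Longrightarrow> r < length ys \<Longrightarrow> (xs @ ys @ us) ! (N + r) = ys ! r"
  by (simp add: nth_append)

lemmas lengths = length_enc_matrix length_sets length_fixed length_point

lemma zs_profit: "r < 2 * (n * m) \<Longrightarrow> zs ! (2 + r) = enc_matrix n m (profit I) ! r"
  unfolding zs_eq by (rule nth_append_offset) (simp_all add: lengths)

lemma zs_demand: "r < 2 * (n * m) \<Longrightarrow> zs ! (2 + 2 * (n * m) + r) = enc_matrix n m (demand I) ! r"
  \<comment> \<open>After associating fully to the left, one rotation is made for each of the four
    blocks behind the demands. This leaves prefix, block and rest as in
    \<open>nth_append_offset\<close>; later blocks need fewer rotations.\<close>
  unfolding zs_eq append_assoc[symmetric]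
  by (subst append_assoc, subst append_assoc, subst append_assoc, subst append_assoc,
     rule nth_append_offset) (simp_all add: lengths)

lemma zs_family: "r < k * n \<Longrightarrow>
    zs ! (2 + 4 * (n * m) + r) = concat (map (enc_set n) (family I)) ! r"
  unfolding zs_eq append_assoc[symmetric]
  by (subst append_assoc, subst append_assoc, subst append_assoc,
     rule nth_append_offset) (simp_all add: lengths)

lemma zs_fixed: "r < k * 2 \<Longrightarrow>
    zs ! (2 + 4 * (n * m) + k * n + r) = concat (map (\<lambda>S. enc_rat (fixed I S)) (family I)) ! r"
  unfolding zs_eq append_assoc[symmetric]
  by (subst append_assoc, subst append_assoc,
     rule nth_append_offset) (simp_all add: lengths)

lemma zs_point: "r < n * 2 \<Longrightarrow>
    zs ! (2 + 4 * (n * m) + k * n + 2 * k + r) = concat (map (\<lambda>i. enc_rat (point I i)) [0..<n]) ! r"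
  unfolding zs_eq append_assoc[symmetric]
  by (subst append_assoc, rule nth_append_offset) (simp_all add: lengths)

lemma zs_level: "r < 2 \<Longrightarrow>
    zs ! (2 + 4 * (n * m) + k * n + 2 * k + 2 * n + r) = enc_rat (level I) ! r"
  unfolding zs_eq append_assoc[symmetric]
  by (simp add: nth_append lengths)

lemma rat_atI:
  assumes "Suc a < length zs" "\<And>r. r < 2 \<Longrightarrow> zs ! (a + r) = enc_rat q ! r"
  shows "rat_at q a"
  using assms(1) assms(2)[of 0] assms(2)[of 1] by (simp add: rat_at_def enc_rat_def)

lemma rat_at_profit: "i < n \<Longrightarrow> j < m \<Longrightarrow> rat_at (profit I i j) (profit_pos i j)"
proof (rule rat_atI)
  assume ij: "i < n" "j < m"
  note p = matrix_pos_less[OF ij]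
  then show "Suc (profit_pos i j) < length zs" by (simp add: profit_pos_def length_zs)
  fix r :: nat assume "r < 2"
  then show "zs ! (profit_pos i j + r) = enc_rat (profit I i j) ! r"
    using zs_profit[of "2 * (i * m + j) + r"] nth_enc_matrix[OF ij \<open>r < 2\<close>] p
    by (simp add: profit_pos_def add.assoc)
qed

lemma rat_at_demand: "i < n \<Longrightarrow> j < m \<Longrightarrow> rat_at (demand I i j) (demand_pos i j)"
proof (rule rat_atI)
  assume ij: "i < n" "j < m"
  note p = matrix_pos_less[OF ij]
  then show "Suc (demand_pos i j) < length zs" 
  proof -
    \<comment> \<open>Fresh variables in place of the products make the inequality linear.\<close>
    have "Suc (2 + 2 * q + 2 * p) < 2 + 4 * q + r + 2 * a + 2 * b + 2" if "p < q" for p q r a b :: nat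
      using that by linarith
    from this[OF p] show ?thesis unfolding demand_pos_def length_zs .
  qed
  fix r :: nat assume "r < 2"
  then show "zs ! (demand_pos i j + r) = enc_rat (demand I i j) ! r"
    using zs_demand[of "2 * (i * m + j) + r"] nth_enc_matrix[OF ij \<open>r < 2\<close>] p
    by (simp add: demand_pos_def add.assoc)
qed

lemma rat_at_fixed: "l < k \<Longrightarrow> rat_at (fixed I (family I ! l)) (fixed_pos l)"
proof (rule rat_atI)
  assume l: "l < k"
  then show "Suc (fixed_pos l) < length zs" by (simp add: fixed_pos_def length_zs)
  fix r :: nat assume r: "r < 2"
  have "concat (map (\<lambda>S. enc_rat (fixed I S)) (family I)) ! (l * 2 + r) = enc_rat (fixed I (family I ! l)) ! r"
    unfolding map_family using l r by (intro concat_map_nth) auto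
  then show "zs ! (fixed_pos l + r) = enc_rat (fixed I (family I ! l)) ! r"
    using zs_fixed[of "l * 2 + r"] matrix_pos_less[OF l r] by (simp add: fixed_pos_def ac_simps)
qed

lemma rat_at_point: "i < n \<Longrightarrow> rat_at (point I i) (point_pos i)"
proof (rule rat_atI)
  assume i: "i < n"
  then show "Suc (point_pos i) < length zs" by (simp add: point_pos_def length_zs)
  fix r :: nat assume r: "r < 2"
  have "concat (map (\<lambda>i. enc_rat (point I i)) [0..<n]) ! (i * 2 + r) = enc_rat (point I i) ! r"
    using i r by (intro concat_map_nth) auto
  then show "zs ! (point_pos i + r) = enc_rat (point I i) ! r"
    using zs_point[of "i * 2 + r"] matrix_pos_less[OF i r] by (simp add: point_pos_def ac_simps)
qed

lemma rat_at_level: "rat_at (level I) level_pos"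
proof (rule rat_atI)
  show "Suc level_pos < length zs" by (simp add: level_pos_def length_zs)
  fix r :: nat assume "r < 2"
  then show "zs ! (level_pos + r) = enc_rat (level I) ! r"
    using zs_level unfolding level_pos_def by blast
qed

lemma family_at:
  assumes l: "l < k" and i: "i < n"
  shows "family_pos l i < length zs" "zs ! family_pos l i = of_bool (i \<in> family I ! l)"
proof -
  note p = matrix_pos_less[OF l i]
  then show "family_pos l i < length zs" by (simp add: family_pos_def length_zs)
  have "concat (map (enc_set n) (family I)) ! (l * n + i) = enc_set n (family I ! l) ! i"
    unfolding map_family using l i by (intro concat_map_nth) auto
  then show "zs ! family_pos l i = of_bool (i \<in> family I ! l)"
    using zs_family[OF p] i by (simp add: family_pos_def enc_set_def add.assoc)
qed

text \<open>The product of all positive input numbers is a multiple of all denominators.\<close>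

definition part_prod :: "nat \<Rightarrow> int" where
  "part_prod l = (\<Prod>a<l. if 0 < zs ! a then zs ! a else 1)"

definition \<Delta> where "\<Delta> = part_prod (length zs)"

lemma L_eq: "L = (\<Sum>a<length zs. bits (zs ! a))"
  by (simp add: L_def encoding_length_def sum_list_sum_nth atLeast0LessThan)

lemma length_zs_le: "length zs \<le> L"
proof -
  have "(\<Sum>a<length zs. 1) \<le> (\<Sum>a<length zs. bits (zs ! a))" by (intro sum_mono bits_ge_1)
  then show ?thesis by (simp add: L_eq)
qed

lemma n_less: "n < L" and k_less: "k < L" and L_pos: "0 < L"
  using length_zs_le k_le unfolding length_zs by linarith+

lemma abs_zs_le: "a < length zs \<Longrightarrow> \<bar>zs ! a\<bar> \<le> 2 ^ L"
proof -
  assume a: "a < length zs"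
  have "bits (zs ! a) \<le> L" unfolding L_eq using a by (intro member_le_sum) auto
  then have "\<bar>zs ! a\<bar> < 2 ^ (L - 1)" using bits_le_iff[of "zs ! a" "L - 1"] L_pos by simp
  also have "\<dots> \<le> (2 :: int) ^ L" by (intro power_increasing) auto
  finally show ?thesis by simp
qed

lemma part_prod_pos: "0 < part_prod l"
  unfolding part_prod_def by (intro prod_pos) simp

text \<open>The bit lengths of the factors add up to at most the encoding length, so even the
  product of all positive input numbers stays short.\<close>

lemma part_prod_le: "l \<le> length zs \<Longrightarrow> part_prod l \<le> 2 ^ L"
proof -
  assume l: "l \<le> length zs"
  have "part_prod l \<le> (\<Prod>a<l. 2 ^ bits (zs ! a))"
    unfolding part_prod_def
  proof (rule prod_mono)
    fix a
    have "\<bar>zs ! a\<bar> < 2 ^ bits (zs ! a)" using bits_le_iff[of "zs ! a" "bits (zs ! a)"] by simp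
    then show "0 \<le> (if 0 < zs ! a then zs ! a else 1) \<and> (if 0 < zs ! a then zs ! a else 1) \<le> 2 ^ bits (zs ! a)"
      by auto
  qed
  also have "\<dots> = 2 ^ (\<Sum>a<l. bits (zs ! a))" by (simp add: power_sum)
  also have "\<dots> \<le> 2 ^ L"
    unfolding L_eq using l by (intro power_increasing sum_mono2) auto
  finally show ?thesis .
qed

lemma \<Delta>_pos: "0 < \<Delta>" and \<Delta>_le: "\<Delta> \<le> 2 ^ L"
  by (auto simp: \<Delta>_def part_prod_pos part_prod_le)

definition scaled :: "rat \<Rightarrow> int" where
  "scaled q = fst (quotient_of q) * (\<Delta> div snd (quotient_of q))"

lemma scaled_rat_at:
  assumes "rat_at q a"
  shows "real_of_int (scaled q) = \<Delta> * of_rat q" and "\<bar>scaled q\<bar> \<le> 2 ^ (2 * L)"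
proof -
  obtain u v where uv: "quotient_of q = (u, v)" by fastforce
  then have v: "0 < v" and q: "q = of_int u / of_int v"
    using quotient_of_denom_pos quotient_of_div by auto
  have a: "Suc a < length zs" "zs ! a = u" "zs ! Suc a = v" using assms uv by (auto simp: rat_at_def)
  \<comment> \<open>The denominator is positive and stored at \<open>Suc a\<close>, hence it is one
    of the factors.\<close>
  have "v dvd \<Delta>"
    unfolding \<Delta>_def part_prod_def
    using a v by (intro dvd_prod_eqI[where a = "Suc a"]) auto
  then obtain c where c: "\<Delta> = v * c" by blast
  have "real_of_int (scaled q) = u * c" using c v uv by (simp add: scaled_def)
  also have "\<dots> = \<Delta> * of_rat q" using v by (simp add: q c of_rat_divide)
  finally show "real_of_int (scaled q) = \<Delta> * of_rat q" .
  have "\<bar>scaled q\<bar> = \<bar>u\<bar> * \<bar>\<Delta> div v\<bar>" by (simp add: scaled_def uv abs_mult)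
  also have "\<dots> \<le> 2 ^ L * 2 ^ L"
    using abs_zs_le[of a] a abs_div_le[of \<Delta> v] \<Delta>_pos \<Delta>_le by (intro mult_mono) auto
  finally show "\<bar>scaled q\<bar> \<le> 2 ^ (2 * L)" by (simp add: mult_2 power_add)
qed

end

section \<open>The program\<close>

text \<open>Expressions have no comparisons, so truth values 0 and 1 are produced by division. As
  \<open>\<bar>z\<bar> < 1 + z * z\<close>, the rounded-down quotient is -1 for negative
  \<open>z\<close> and 0 otherwise. Similarly \<open>Eq\<close> divides 1 by a number that exceeds 1
  unless both sides agree.\<close>

definition Neg :: "expr \<Rightarrow> expr" where
  "Neg e = Sub (Const 0) (Div e (Add (Const 1) (Mul e e)))"

definition Complement :: "expr \<Rightarrow> expr" where
  "Complement e = Sub (Const 1) e"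

definition Or :: "expr \<Rightarrow> expr \<Rightarrow> expr" where
  "Or e f = Complement (Mul (Complement e) (Complement f))"

definition Eq :: "expr \<Rightarrow> expr \<Rightarrow> expr" where
  "Eq e f = Div (Const 1) (Add (Const 1) (Mul (Sub e f) (Sub e f)))"

definition Mod :: "expr \<Rightarrow> expr \<Rightarrow> expr" where
  "Mod e f = Sub e (Mul f (Div e f))"

text \<open>Unrolled when the program text is built: \<open>m\<close> is constant, so these
  expressions grow with \<open>m\<close> but not with the instance.\<close>

primrec Sum :: "(nat \<Rightarrow> expr) \<Rightarrow> nat \<Rightarrow> expr" where
  "Sum f 0 = Const 0"
| "Sum f (Suc j) = Add (Sum f j) (f j)"

primrec Pow :: "expr \<Rightarrow> nat \<Rightarrow> expr" where
  "Pow e 0 = Const 1"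
| "Pow e (Suc j) = Mul e (Pow e j)"

lemma val_Neg [simp]: "val (Neg e) s = of_bool (val e s < 0)"
proof -
  let ?z = "val e s"
  have "?z div (1 + ?z * ?z) = - of_bool (?z < 0)"
  proof (cases "?z < 0")
    case True
    then have "- ?z * 1 \<le> - ?z * - ?z" by (intro mult_left_mono) auto
    then have "(- ?z) div (- (1 + ?z * ?z)) = -1" using True by (intro div_pos_neg_trivial) auto
    then show ?thesis using True by (simp only: div_minus_minus) simp
  next
    case False
    then have "?z < 1 + ?z * ?z" by (smt (verit) mult_le_cancel_left1)
    then show ?thesis using False by simp
  qed
  then show ?thesis by (simp add: Neg_def)
qed

lemma val_Complement [simp]: "val (Complement e) s = 1 - val e s"
  by (simp add: Complement_def)

lemma val_Or: "val e s = of_bool P \<Longrightarrow> val f s = of_bool Q \<Longrightarrow> val (Or e f) s = of_bool (P \<or> Q)"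
  by (simp add: Or_def)

lemma val_Eq [simp]: "val (Eq e f) s = of_bool (val e s = val f s)"
proof (cases "val e s = val f s")
  case False
  define z where "z = val e s - val f s"
  have "0 < z * z" using False by (simp add: z_def zero_less_mult_iff) linarith
  then have "1 div (1 + z * z) = 0" by simp
  then show ?thesis using False by (simp add: Eq_def z_def)
qed (simp add: Eq_def)

lemma val_Mod [simp]: "val (Mod e f) s = val e s mod val f s"
  by (simp add: Mod_def minus_mult_div_eq_mod)

lemma val_Sum [simp]: "val (Sum f j) s = (\<Sum>i<j. val (f i) s)"
  by (induction j) auto

lemma val_Pow [simp]: "val (Pow e j) s = val e s ^ j"
  by (induction j) auto

section \<open>Addresses in the input array\<close>

abbreviation In :: "expr \<Rightarrow> expr" where "In \<equiv> Read ''in''"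
abbreviation nE :: expr where "nE \<equiv> In (Const 0)"
abbreviation kE :: expr where "kE \<equiv> In (Const 1)"

definition Profit :: "nat \<Rightarrow> expr \<Rightarrow> nat \<Rightarrow> expr" where
  "Profit m i j = Add (Const 2) (Mul (Const 2) (Add (Mul i (Const (int m))) (Const (int j))))"

definition Demand :: "nat \<Rightarrow> expr \<Rightarrow> nat \<Rightarrow> expr" where
  "Demand m i j = Add (Mul (Const 2) (Mul nE (Const (int m)))) (Profit m i j)"

definition Family :: "nat \<Rightarrow> expr \<Rightarrow> expr \<Rightarrow> expr" where
  "Family m l i = Add (Add (Add (Const 2) (Mul (Const 4) (Mul nE (Const (int m))))) (Mul l nE)) i"

text \<open>Row \<open>k\<close> of the family, one past the last, is where the next block starts;
  \<open>Point\<close> and \<open>Level\<close> are derived in the same way.\<close>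

definition Fixed :: "nat \<Rightarrow> expr \<Rightarrow> expr" where
  "Fixed m l = Add (Family m kE (Const 0)) (Mul (Const 2) l)"

definition Point :: "nat \<Rightarrow> expr \<Rightarrow> expr" where
  "Point m i = Add (Fixed m kE) (Mul (Const 2) i)"

definition Level :: "nat \<Rightarrow> expr" where
  "Level m = Point m nE"

definition Scaled :: "expr \<Rightarrow> expr" where
  "Scaled e = Mul (In e) (Div (Var ''delta'') (In (Add e (Const 1))))"

text \<open>The factor is \<open>z\<close> for a positive input number \<open>z\<close> and 1
  otherwise; \<open>Level m\<close> plus 2 is the length of the input.\<close>

definition scaling :: "nat \<Rightarrow> program" where
  "scaling m = Seq (Write ''delta'' (Const 0) (Const 1))
     (Accumulate ''delta'' ''i'' (Add (Level m) (Const 2))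
       (Mul (Var ''delta'')
         (Add (Const 1) (Mul (Neg (Sub (Const 0) (In (Var ''i'')))) (Sub (In (Var ''i'')) (Const 1))))))"

definition report :: "int \<Rightarrow> expr \<Rightarrow> program" where
  "report kind f = Seq (Write ''out'' (Const 0) (Const kind)) (Fill ''out'' 1 ''i'' nE f)"

text \<open>The loop does not stop at a violation; a later one overwrites the report.\<close>

definition equalities :: "nat \<Rightarrow> program" where
  "equalities m = For ''l'' kE
     (Seq (Total ''acc'' ''i'' nE
            (Mul (In (Family m (Var ''l'') (Var ''i''))) (Scaled (Point m (Var ''i'')))))
     (IfPos (Complement (Eq (Var ''acc'') (Scaled (Fixed m (Var ''l'')))))
        (report 2 (In (Family m (Var ''l'') (Var ''i'')))) Skip))"

abbreviation Entry :: "expr \<Rightarrow> expr \<Rightarrow> expr" where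
  "Entry i j \<equiv> Read ''M'' (Add (Mul i nE) j)"

text \<open>The family and \<open>M\<close> are both stored row by row with row length
  \<open>n\<close>, so one linear copy of \<open>k * n\<close> cells does it.\<close>

definition init_matrix :: "nat \<Rightarrow> program" where
  "init_matrix m = Seq (Fill ''M'' 0 ''i'' (Mul kE nE) (In (Family m (Const 0) (Var ''i''))))
     (Write ''D'' (Const 0) (Const 1))"

text \<open>Moving \<open>c\<close> to \<open>i\<close> is expressed as adding \<open>i - c\<close>
  times the indicator of a nonzero entry; the last such column wins.\<close>

definition find_pivot :: program where
  "find_pivot = Accumulate ''c'' ''i'' nE (Add (Var ''c'')
     (Mul (Complement (Eq (Entry (Var ''r'') (Var ''i'')) (Const 0))) (Sub (Var ''i'') (Var ''c''))))"

text \<open>The summand with \<open>Eq\<close> makes the formula valid in the pivot row as well, which does not change.\<close>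

definition pivot_step :: program where
  "pivot_step = Fill ''M2'' 0 ''i'' (Mul kE nE)
     (Div (Sub (Mul (Entry (Var ''r'') (Var ''c'')) (Read ''M'' (Var ''i'')))
               (Mul (Sub (Entry (Div (Var ''i'') nE) (Var ''c''))
                         (Mul (Eq (Div (Var ''i'') nE) (Var ''r'')) (Var ''D'')))
                    (Entry (Var ''r'') (Mod (Var ''i'') nE))))
          (Var ''D''))"

definition elimination_round :: program where
  "elimination_round =
     Seq (Write ''c'' (Const 0) (Const 0))
    (Seq find_pivot
    (Seq (Write ''C'' (Var ''r'') (Var ''c''))
    (Seq pivot_step
    (Seq (Write ''D'' (Const 0) (Entry (Var ''r'') (Var ''c'')))
         (Fill ''M'' 0 ''i'' (Mul kE nE) (Read ''M2'' (Var ''i'')))))))"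

definition elimination :: "nat \<Rightarrow> program" where
  "elimination m = Seq (init_matrix m) (For ''r'' kE elimination_round)"

text \<open>\<open>t\<close> packs two loops into one: its quotient by \<open>n + 1\<close> numbers
  the choice of players, its remainder is the exchanged player, or \<open>n\<close> for
  none.\<close>

definition Digit :: "nat \<Rightarrow> expr" where
  "Digit j = Mod (Div (Div (Var ''t'') (Add nE (Const 1))) (Pow nE j)) nE"

text \<open>Products of scaled demands and profits carry \<open>\<Delta>\<close> twice, hence the
  additional factor for the point.\<close>

definition compute_weights :: "nat \<Rightarrow> program" where
  "compute_weights m = Fill ''w'' 0 ''i'' nE
     (Sub (Mul (Var ''delta'') (Scaled (Point m (Var ''i''))))
          (Sum (\<lambda>j. Mul (Scaled (Demand m (Var ''i'') j)) (Scaled (Profit m (Digit j) j))) m))"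

text \<open>A nonzero number of digits equal to \<open>i\<close> signals a chosen player. On truth
  values, \<open>Complement\<close> of \<open>Eq\<close> is exclusive or, which here expresses the
  equivalence in \<open>candidate\<close>.\<close>

definition compute_candidate :: "nat \<Rightarrow> program" where
  "compute_candidate m = Fill ''S'' 0 ''i'' nE
     (Or (Complement (Eq (Sum (\<lambda>j. Eq (Var ''i'') (Digit j)) m) (Const 0)))
         (Complement (Eq (Neg (Read ''w'' (Var ''i'')))
                  (Eq (Var ''i'') (Mod (Var ''t'') (Add nE (Const 1)))))))"

definition compute_total :: program where
  "compute_total = Total ''acc'' ''i'' nE (Mul (Read ''S'' (Var ''i'')) (Read ''w'' (Var ''i'')))"

definition span_test :: program where
  "span_test = For ''j'' nE
     (Seq (Total ''sum'' ''i'' kE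
            (Mul (Read ''S'' (Read ''C'' (Var ''i''))) (Entry (Var ''i'') (Var ''j''))))
          (Write ''outside'' (Const 0) (Or (Var ''outside'')
            (Complement (Eq (Var ''sum'') (Mul (Var ''D'') (Read ''S'' (Var ''j''))))))))"

definition enumeration_round :: "nat \<Rightarrow> program" where
  "enumeration_round m =
     Seq (compute_weights m)
    (Seq (compute_candidate m)
    (Seq compute_total
    (Seq (Write ''outside'' (Const 0) (Const 0))
    (Seq span_test
    (IfPos (Mul (Var ''outside'') (Neg (Sub (Var ''acc'') (Mul (Var ''delta'') (Scaled (Level m))))))
       (report 1 (Read ''S'' (Var ''i''))) Skip)))))"

definition enumeration :: "nat \<Rightarrow> program" where
  "enumeration m = For ''t'' (Mul (Add nE (Const 1)) (Pow nE m)) (enumeration_round m)"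

lemma writes_parts [simp]:
  "writes (report kind f) = {''i'', ''out''}"
  "writes (scaling m) = {''i'', ''delta''}"
  "writes (equalities m) = {''l'', ''i'', ''acc'', ''out''}"
  "writes (init_matrix m) = {''i'', ''M'', ''D''}"
  "writes find_pivot = {''i'', ''c''}"
  "writes pivot_step = {''i'', ''M2''}"
  "writes elimination_round = {''i'', ''c'', ''C'', ''M2'', ''D'', ''M''}"
  "writes (elimination m) = {''r'', ''i'', ''c'', ''C'', ''M2'', ''D'', ''M''}"
  "writes (compute_weights m) = {''i'', ''w''}"
  "writes (compute_candidate m) = {''i'', ''S''}"
  "writes compute_total = {''i'', ''acc''}"
  "writes span_test = {''j'', ''i'', ''sum'', ''outside''}"
  "writes (enumeration_round m) = {''i'', ''w'', ''S'', ''acc'', ''outside'', ''j'', ''sum'', ''out''}"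
  by (auto simp: report_def scaling_def equalities_def init_matrix_def find_pivot_def pivot_step_def
      elimination_round_def elimination_def compute_weights_def compute_candidate_def
      compute_total_def span_test_def enumeration_round_def)

definition separation :: "nat \<Rightarrow> program" where
  "separation m = Seq (scaling m) (Seq (equalities m) (Seq (elimination m) (enumeration m)))"

context sep_problem
begin

text \<open>Exceeds every loop count; the largest power of \<open>n\<close> occurs in
  \<open>(n + 1) * n ^ m\<close>, the number of tested coalitions.\<close>

definition rounds where "rounds = (L + 1) ^ (m + 2)"
text \<open>The exponent dominates that of all large numbers: loop counts up to
  \<open>L ^ (m + 2)\<close>, hence up to \<open>2 ^ (L * (m + 2))\<close>, sums in the span test up
  to \<open>2 ^ (L * (L + 1))\<close>, and sums of weights up to
  \<open>2 ^ (m + L * 5)\<close>.\<close>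

definition H :: int where "H = 2 ^ (m + L * (L + m + 5))"

definition loaded :: "memory \<Rightarrow> bool" where
  "loaded s \<longleftrightarrow> s ''in'' = initial_memory zs ''in''"

lemma power_le_H: "e \<le> m + L * (L + m + 5) \<Longrightarrow> 2 ^ e \<le> H"
  unfolding H_def by (intro power_increasing) auto

lemma one_le_H: "1 \<le> H"
  unfolding H_def by simp

lemma bits_H: "bits H = m + L * (L + m + 5) + 2"
proof -
  have "bits H \<le> Suc (Suc (m + L * (L + m + 5)))" unfolding bits_le_iff by (simp add: H_def)
  moreover have "\<not> bits H \<le> Suc (m + L * (L + m + 5))" unfolding bits_le_iff by (simp add: H_def)
  ultimately show ?thesis by simp
qed

lemma less_two_power: "int a \<le> 2 ^ a"
  using less_exp[of a] by (metis of_nat_le_iff of_nat_numeral of_nat_power order_less_imp_le)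

lemma n_le_power: "int n \<le> 2 ^ L"
  using less_two_power[of L] n_less by linarith

lemma int_le_H:
  assumes "a \<le> L ^ m * L ^ 2"
  shows "int a \<le> H"
proof -
  have "int a \<le> int L ^ (m + 2)"
    using assms unfolding power_add[symmetric] by (simp only: of_nat_le_iff flip: of_nat_power)
  also have "\<dots> \<le> (2 ^ L) ^ (m + 2)" by (intro power_mono less_two_power) simp
  also have "\<dots> = 2 ^ (L * (m + 2))" by (simp only: power_mult)
  also have "\<dots> \<le> H" by (rule power_le_H, rule trans_le_add2, rule mult_left_mono) auto
  finally show ?thesis .
qed

lemma le_rounds: "a \<le> L ^ m * L ^ 2 \<Longrightarrow> a \<le> rounds"
proof -
  assume "a \<le> L ^ m * L ^ 2"
  also have "\<dots> = L ^ (m + 2)" by (simp only: power_add)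
  also have "\<dots> \<le> rounds" unfolding rounds_def by (intro power_mono) auto
  finally show ?thesis .
qed

lemma
  shows n_count: "n \<le> L ^ m * L ^ 2" and k_count: "k \<le> L ^ m * L ^ 2"
    and kn_count: "k * n \<le> L ^ m * L ^ 2" and zs_count: "length zs \<le> L ^ m * L ^ 2"
    and t_count: "(n + 1) * n ^ m \<le> L ^ m * L ^ 2"
proof -
  have L: "1 \<le> L" "L \<le> L ^ 2" "1 \<le> L ^ m" using L_pos by (auto simp: power2_eq_square)
  have up: "a \<le> L ^ m * L ^ 2" if "a \<le> L ^ 2" for a
    using mult_mono[OF L(3) that] by simp
  show "n \<le> L ^ m * L ^ 2" "k \<le> L ^ m * L ^ 2" "length zs \<le> L ^ m * L ^ 2"
    using n_less k_less length_zs_le L by (auto intro!: up)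
  show "k * n \<le> L ^ m * L ^ 2"
    using n_less k_less by (intro up) (auto simp: power2_eq_square intro!: mult_mono)
  have "(n + 1) * n ^ m \<le> L * L ^ m" using n_less by (intro mult_mono power_mono) auto
  also have "\<dots> \<le> L ^ m * L ^ 2"
    unfolding mult.commute[of L] by (intro mult_left_mono L(2)) simp
  finally show "(n + 1) * n ^ m \<le> L ^ m * L ^ 2" .
qed

lemmas counts = le_rounds[OF n_count] le_rounds[OF k_count] le_rounds[OF kn_count]
  le_rounds[OF zs_count] le_rounds[OF t_count, simplified] int_le_H[OF n_count] int_le_H[OF k_count]
  int_le_H[OF kn_count, simplified] int_le_H[OF zs_count] int_le_H[OF t_count, simplified]

lemma loaded_nth: "loaded s \<Longrightarrow> a < length zs \<Longrightarrow> s ''in'' (int a) = zs ! a"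
  by (simp add: loaded_def initial_memory_def)

lemma val_nk:
  assumes "loaded s"
  shows "s ''in'' 0 = int n" "s ''in'' 1 = int k"
  using loaded_nth[OF assms, of 0] loaded_nth[OF assms, of 1] zs_0 zs_1 length_zs by auto

lemma val_positions:
  assumes "loaded s"
  shows "val i s = int i' \<Longrightarrow> val (Profit m i j) s = int (profit_pos i' j)"
    and "val i s = int i' \<Longrightarrow> val (Demand m i j) s = int (demand_pos i' j)"
    and "val l s = int l' \<Longrightarrow> val i s = int i' \<Longrightarrow> val (Family m l i) s = int (family_pos l' i')"
    and "val l s = int l' \<Longrightarrow> val (Fixed m l) s = int (fixed_pos l')"
    and "val i s = int i' \<Longrightarrow> val (Point m i) s = int (point_pos i')"
    and "val (Level m) s = int level_pos"
  by (simp_all add: Profit_def Demand_def Family_def Fixed_def Point_def Level_def val_nk[OF assms]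
      profit_pos_def demand_pos_def family_pos_def fixed_pos_def point_pos_def level_pos_def algebra_simps)

definition ready :: "memory \<Rightarrow> bool" where
  "ready s \<longleftrightarrow> loaded s \<and> s ''delta'' 0 = \<Delta>"

lemma val_Scaled:
  assumes "ready s" "rat_at q a" "val e s = int a"
  shows "val (Scaled e) s = scaled q"
  using assms loaded_nth[of s a] loaded_nth[of s "Suc a"]
  by (simp add: Scaled_def ready_def rat_at_def scaled_def add.commute)

lemma val_inputs:
  assumes s: "ready s"
  shows "val i s = int i' \<Longrightarrow> i' < n \<Longrightarrow> j < m \<Longrightarrow> val (Scaled (Profit m i j)) s = scaled (profit I i' j)"
    and "val i s = int i' \<Longrightarrow> i' < n \<Longrightarrow> j < m \<Longrightarrow> val (Scaled (Demand m i j)) s = scaled (demand I i' j)"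
    and "val l s = int l' \<Longrightarrow> l' < k \<Longrightarrow> val (Scaled (Fixed m l)) s = scaled (fixed I (family I ! l'))"
    and "val i s = int i' \<Longrightarrow> i' < n \<Longrightarrow> val (Scaled (Point m i)) s = scaled (point I i')"
    and "val (Scaled (Level m)) s = scaled (level I)"
proof -
  have l: "loaded s" using s by (simp add: ready_def)
  note p = val_positions[OF l]
  note v = val_Scaled[OF s]
  show "val i s = int i' \<Longrightarrow> i' < n \<Longrightarrow> j < m \<Longrightarrow> val (Scaled (Profit m i j)) s = scaled (profit I i' j)"
    using v[OF rat_at_profit p(1)] by blast
  show "val i s = int i' \<Longrightarrow> i' < n \<Longrightarrow> j < m \<Longrightarrow> val (Scaled (Demand m i j)) s = scaled (demand I i' j)"
    using v[OF rat_at_demand p(2)] by blast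
  show "val l s = int l' \<Longrightarrow> l' < k \<Longrightarrow> val (Scaled (Fixed m l)) s = scaled (fixed I (family I ! l'))"
    using v[OF rat_at_fixed p(4)] by blast
  show "val i s = int i' \<Longrightarrow> i' < n \<Longrightarrow> val (Scaled (Point m i)) s = scaled (point I i')"
    using v[OF rat_at_point p(5)] by blast
  show "val (Scaled (Level m)) s = scaled (level I)"
    using v[OF rat_at_level p(6)] .
qed

lemma val_Family:
  assumes "loaded s" "val l s = int l'" "val i s = int i'" "l' < k" "i' < n"
  shows "val (In (Family m l i)) s = of_bool (i' \<in> family I ! l')"
  using val_positions(3)[OF assms(1-3)] loaded_nth[OF assms(1) family_at(1)[OF assms(4,5)]]
    family_at(2)[OF assms(4,5)] by simp

lemma runs_scaling:
  assumes s: "loaded s"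
  shows "runs rounds H (scaling m) s ready"
  unfolding scaling_def
proof (rule runs_Seq)
  show "runs rounds H (Write ''delta'' (Const 0) (Const 1)) s (\<lambda>s'. s' ''delta'' 0 = 1)"
    by (rule runs_Write) (simp_all add: one_le_H)
  fix s' assume "agree (writes (Write ''delta'' (Const 0) (Const 1))) s s'" and d: "s' ''delta'' 0 = 1"
  then have s': "loaded s'" using s by (simp add: loaded_def)
  show "runs rounds H (Accumulate ''delta'' ''i'' (Add (Level m) (Const 2))
       (Mul (Var ''delta'')
         (Add (Const 1) (Mul (Neg (Sub (Const 0) (In (Var ''i'')))) (Sub (In (Var ''i'')) (Const 1)))))) s' ready"
  proof (rule runs_conseq)
    show "runs rounds H (Accumulate ''delta'' ''i'' (Add (Level m) (Const 2))
       (Mul (Var ''delta'')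
         (Add (Const 1) (Mul (Neg (Sub (Const 0) (In (Var ''i'')))) (Sub (In (Var ''i'')) (Const 1)))))) s'
       (\<lambda>s. s ''delta'' 0 = part_prod (length zs))"
    proof (rule runs_Accumulate)
      fix s'' assume "agree {''i'', ''delta''} s' s''"
      then have "loaded s''" using s' by (simp add: loaded_def)
      then show "val (Add (Level m) (Const 2)) s'' = int (length zs)"
        by (simp add: val_positions(6) level_pos_def length_zs)
    next
      fix i s'' assume i: "i < length zs" and a: "agree {''i'', ''delta''} s' s''" "s'' ''i'' 0 = int i"
        and d: "s'' ''delta'' 0 = part_prod i"
      then have "loaded s''" using s' by (simp add: loaded_def)
      then show "val (Mul (Var ''delta'')
         (Add (Const 1) (Mul (Neg (Sub (Const 0) (In (Var ''i'')))) (Sub (In (Var ''i'')) (Const 1))))) s''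
         = part_prod (Suc i)"
        using i a d loaded_nth[of s'' i] by (simp add: part_prod_def)
    next
      fix i assume "i \<le> length zs"
      moreover have "(2 :: int) ^ L \<le> H"
        by (rule power_le_H) (simp add: trans_le_add2)
      ultimately show "\<bar>part_prod i\<bar> \<le> H"
        using part_prod_pos[of i] part_prod_le[of i] by simp
    qed (use d in \<open>simp_all add: counts part_prod_def\<close>)
    fix s'' assume "agree (writes (Accumulate ''delta'' ''i'' (Add (Level m) (Const 2))
       (Mul (Var ''delta'')
         (Add (Const 1) (Mul (Neg (Sub (Const 0) (In (Var ''i'')))) (Sub (In (Var ''i'')) (Const 1))))))) s' s''"
      "s'' ''delta'' 0 = part_prod (length zs)"
    then show "ready s''" using s' by (simp add: ready_def loaded_def \<Delta>_def)
  qed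
qed

section \<open>Answers and the equality constraints\<close>

definition satisfied :: "lp_constraint \<Rightarrow> bool" where
  "satisfied con \<longleftrightarrow> satisfies (inst_value m I) (inst_fixed I) (inst_point I) con"

text \<open>\<open>P\<close> records what has been checked and is claimed only while nothing is
  reported. Once a violated constraint stands in the output, the verdict holds for every
  \<open>P\<close>, so the loops may continue and overwrite it.\<close>

definition verdict :: "bool \<Rightarrow> memory \<Rightarrow> bool" where
  "verdict P s \<longleftrightarrow> decode_answer n s = None \<and> P \<or>
     (\<exists>con. decode_answer n s = Some con \<and> correct_answer m I (Some con))"

lemma verdict_cong: "s' ''out'' = s ''out'' \<Longrightarrow> verdict P s' = verdict P s"
  by (simp add: verdict_def decode_answer_def)

lemma verdict_weaken: "verdict P s \<Longrightarrow> (P \<Longrightarrow> Q) \<Longrightarrow> verdict Q s"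
  by (auto simp: verdict_def)

lemma verdict_violated:
  assumes "decode_answer n s = Some con" "con \<in> lp_constraints n (family I)" "\<not> satisfied con"
  shows "verdict P s"
  using assms by (simp add: verdict_def satisfied_def n_def)

lemma runs_report:
  assumes s: "loaded s" and S: "S \<subseteq> {..<n}" and kind: "kind = 1 \<or> kind = 2"
    and f: "\<And>i s'. i < n \<Longrightarrow> agree {''i'', ''out''} s s' \<Longrightarrow> s' ''i'' 0 = int i \<Longrightarrow>
      val f s' = of_bool (i \<in> S)"
  shows "runs rounds H (report kind f) s (\<lambda>s'. decode_answer n s' =
    Some (if kind = 1 then Inequality S else Equality S))"
  unfolding report_def
proof (rule runs_Seq)
  have "(2 :: int) ^ 1 \<le> H" using L_pos by (intro power_le_H) (auto simp: Suc_le_eq)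
  then show "runs rounds H (Write ''out'' (Const 0) (Const kind)) s (\<lambda>s'. s' ''out'' 0 = kind)"
    using kind by (intro runs_Write) auto
  fix s' assume a: "agree (writes (Write ''out'' (Const 0) (Const kind))) s s'" and out: "s' ''out'' 0 = kind"
  then have s': "loaded s'" using s by (simp add: loaded_def)
  show "runs rounds H (Fill ''out'' 1 ''i'' nE f) s' (\<lambda>s'. decode_answer n s' =
    Some (if kind = 1 then Inequality S else Equality S))"
  proof (rule runs_conseq)
    show "runs rounds H (Fill ''out'' 1 ''i'' nE f) s' (\<lambda>s''.
      (\<forall>i<n. s'' ''out'' (int (1 + i)) = of_bool (i \<in> S)) \<and>
      (\<forall>j. j < int 1 \<or> j \<ge> int (1 + n) \<longrightarrow> s'' ''out'' j = s' ''out'' j))"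
    proof (rule runs_Fill)
      fix s'' assume "agree {''i'', ''out''} s' s''"
      then have "loaded s''" using s' by (simp add: loaded_def)
      then show "val nE s'' = int n" by (simp add: val_nk)
    next
      fix i s'' assume "i < n" "agree {''i'', ''out''} s' s''" "s'' ''i'' 0 = int i"
      then show "val f s'' = of_bool (i \<in> S)" using a by (intro f) auto
    qed (use one_le_H in \<open>simp_all add: counts\<close>)
    fix s'' assume *: "(\<forall>i<n. s'' ''out'' (int (1 + i)) = of_bool (i \<in> S)) \<and>
      (\<forall>j. j < int 1 \<or> j \<ge> int (1 + n) \<longrightarrow> s'' ''out'' j = s' ''out'' j)"
    then have "{i. i < n \<and> s'' ''out'' (1 + int i) \<noteq> 0} = S" using S by auto
    moreover have "s'' ''out'' 0 = kind" using * out by simp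
    ultimately show "decode_answer n s'' = Some (if kind = 1 then Inequality S else Equality S)"
      using kind by (auto simp: decode_answer_def Let_def)
  qed
qed

lemma family_subset: "l < k \<Longrightarrow> family I ! l \<subseteq> {..<n}"
  using valid by (simp add: valid_instance_def n_def k_def)

lemma scaled_point: "i < n \<Longrightarrow> real_of_int (scaled (point I i)) = \<Delta> * of_rat (point I i)"
  and scaled_level: "real_of_int (scaled (level I)) = \<Delta> * of_rat (level I)"
  and scaled_fixed: "l < k \<Longrightarrow> real_of_int (scaled (fixed I (family I ! l))) = \<Delta> * of_rat (fixed I (family I ! l))"
  and scaled_profit: "i < n \<Longrightarrow> j < m \<Longrightarrow> real_of_int (scaled (profit I i j)) = \<Delta> * of_rat (profit I i j)"
  and scaled_demand: "i < n \<Longrightarrow> j < m \<Longrightarrow> real_of_int (scaled (demand I i j)) = \<Delta> * of_rat (demand I i j)"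
  by (auto intro: scaled_rat_at rat_at_point rat_at_level rat_at_fixed rat_at_profit rat_at_demand)

text \<open>Multiplication by the positive \<open>\<Delta>\<close> turns the rational equation into
  the integer equation that the program evaluates.\<close>

lemma satisfied_Equality:
  assumes l: "l < k"
  shows "satisfied (Equality (family I ! l)) \<longleftrightarrow>
    (\<Sum>i<n. of_bool (i \<in> family I ! l) * scaled (point I i)) = scaled (fixed I (family I ! l))"
proof -
  let ?S = "family I ! l"
  have "real_of_int (\<Sum>i<n. of_bool (i \<in> ?S) * scaled (point I i)) =
      \<Delta> * (\<Sum>i<n. of_bool (i \<in> ?S) * of_rat (point I i))"
    unfolding of_int_sum sum_distrib_left by (intro sum.cong) (auto simp: scaled_point)
  also have "(\<Sum>i<n. of_bool (i \<in> ?S) * of_rat (point I i)) = (\<Sum>i\<in>?S. real_of_rat (point I i))"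
    by (rule sum_eq_sum_of_bool[symmetric, OF family_subset[OF l]])
  finally have "(\<Sum>i<n. of_bool (i \<in> ?S) * scaled (point I i)) = scaled (fixed I ?S) \<longleftrightarrow>
      \<Delta> * (\<Sum>i\<in>?S. real_of_rat (point I i)) = \<Delta> * of_rat (fixed I ?S)"
    unfolding scaled_fixed[OF l, symmetric] by linarith
  then show ?thesis using \<Delta>_pos by (simp add: satisfied_def inst_point_def inst_fixed_def)
qed

lemma abs_partial_sum_le:
  fixes g :: "nat \<Rightarrow> int"
  assumes "l \<le> N" "\<And>i. i < N \<Longrightarrow> \<bar>g i\<bar> \<le> B"
  shows "\<bar>\<Sum>i<l. g i\<bar> \<le> int N * B"
proof (cases "N = 0")
  case False
  then have B: "0 \<le> B" using assms(2)[of 0] by simp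
  have "\<bar>\<Sum>i<l. g i\<bar> \<le> (\<Sum>i<l. B)"
    using assms by (intro order_trans[OF sum_abs] sum_mono) auto
  also have "\<dots> = int l * B" by simp
  also have "\<dots> \<le> int N * B" using assms(1) B by (intro mult_right_mono) auto
  finally show ?thesis .
qed (use assms in simp)

lemma runs_equalities:
  assumes s: "ready s" and out: "s ''out'' 0 = 0"
  shows "runs rounds H (equalities m) s (verdict (\<forall>l<k. satisfied (Equality (family I ! l))))"
proof -
  let ?sum = "Total ''acc'' ''i'' nE
            (Mul (In (Family m (Var ''l'') (Var ''i''))) (Scaled (Point m (Var ''i''))))"
  let ?rep = "report 2 (In (Family m (Var ''l'') (Var ''i'')))"
  let ?if = "IfPos (Complement (Eq (Var ''acc'') (Scaled (Fixed m (Var ''l''))))) ?rep Skip"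
  let ?Inv = "\<lambda>i. verdict (\<forall>l<i. satisfied (Equality (family I ! l)))"
  show ?thesis
    unfolding equalities_def
  proof (rule runs_For[where cnt = k and Inv = ?Inv])
    fix s' assume "agree (insert ''l'' (writes (Seq ?sum ?if))) s s'"
    then show "val kE s' = int k" using s by (simp add: ready_def loaded_def val_nk)
  next
    fix l s1 assume l: "l < k" and "agree (insert ''l'' (writes (Seq ?sum ?if))) s s1"
      and s1_l: "s1 ''l'' 0 = int l" and inv: "?Inv l s1"
    then have s1: "ready s1" using s by (simp add: ready_def loaded_def)
    let ?S = "family I ! l"
    let ?g = "\<lambda>i. of_bool (i \<in> ?S) * scaled (point I i)"
    show "runs rounds H (Seq ?sum ?if) s1 (\<lambda>s2. ?Inv (Suc l) (put ''l'' 0 (int l + 1) s2))"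
    proof (rule runs_Seq)
      show "runs rounds H ?sum s1 (\<lambda>s'. s' ''acc'' 0 = (\<Sum>i<n. ?g i))"
      proof (rule runs_Total)
        fix s' assume "agree {''i'', ''acc''} s1 s'"
        then show "val nE s' = int n" using s1 by (simp add: ready_def loaded_def val_nk)
      next
        fix i s' assume i: "i < n" and a: "agree {''i'', ''acc''} s1 s'" "s' ''i'' 0 = int i"
        then have "ready s'" "s' ''l'' 0 = int l" using s1 s1_l by (simp_all add: ready_def loaded_def)
        then show "val (Mul (In (Family m (Var ''l'') (Var ''i''))) (Scaled (Point m (Var ''i'')))) s' = ?g i"
          using val_Family[of s' "Var ''l''" l "Var ''i''" i] val_inputs(4)[of s' "Var ''i''" i] l i a
          by (simp add: ready_def)
      next
        fix i assume "i \<le> n"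
        then have "\<bar>\<Sum>i<i. ?g i\<bar> \<le> int n * 2 ^ (2 * L)"
          using scaled_rat_at(2)[OF rat_at_point] by (intro abs_partial_sum_le) (auto simp: abs_mult)
        also have "\<dots> \<le> 2 ^ L * 2 ^ (2 * L)"
          by (intro mult_right_mono n_le_power) auto
        also have "\<dots> = 2 ^ (L * 3)" by (simp flip: power_add)
        also have "\<dots> \<le> H" by (rule power_le_H, rule trans_le_add2, rule mult_left_mono) auto
        finally show "\<bar>\<Sum>i<i. ?g i\<bar> \<le> H" .
      qed (simp_all add: counts)
      fix s3 assume a3: "agree (writes ?sum) s1 s3" and acc3: "s3 ''acc'' 0 = (\<Sum>i<n. ?g i)"
      have s3: "ready s3" "s3 ''l'' 0 = int l" using a3 s1 s1_l by (simp_all add: ready_def loaded_def)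
      have out3: "s3 ''out'' = s1 ''out''" using a3 by simp
      have test: "val (Complement (Eq (Var ''acc'') (Scaled (Fixed m (Var ''l''))))) s3 > 0 \<longleftrightarrow> \<not> satisfied (Equality ?S)"
        using val_inputs(3)[OF s3(1), of "Var ''l''" l] s3 l acc3 by (simp add: satisfied_Equality)
      show "runs rounds H ?if s3 (\<lambda>s2. ?Inv (Suc l) (put ''l'' 0 (int l + 1) s2))"
      proof (rule runs_IfPos, unfold test)
        assume viol: "\<not> satisfied (Equality ?S)"
        show "runs rounds H ?rep s3 (\<lambda>s2. ?Inv (Suc l) (put ''l'' 0 (int l + 1) s2))"
        proof (rule runs_conseq)
          show "runs rounds H ?rep s3 (\<lambda>s'. decode_answer n s' =
              Some (if 2 = (1::int) then Inequality ?S else Equality ?S))"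
          proof (rule runs_report)
            fix i s' assume "i < n" "agree {''i'', ''out''} s3 s'" "s' ''i'' 0 = int i"
            then show "val (In (Family m (Var ''l'') (Var ''i''))) s' = of_bool (i \<in> ?S)"
              using s3 l by (intro val_Family) (simp_all add: ready_def loaded_def)
          qed (use s3 family_subset[OF l] in \<open>auto simp: ready_def\<close>)
          fix s4 assume "decode_answer n s4 = Some (if 2 = (1::int) then Inequality ?S else Equality ?S)"
          then show "?Inv (Suc l) (put ''l'' 0 (int l + 1) s4)"
            using viol l by (intro verdict_violated[where con = "Equality ?S"])
              (auto simp: decode_answer_def lp_constraints_def k_def)
        qed
      next
        assume "\<not> \<not> satisfied (Equality ?S)"
        moreover have "?Inv l (put ''l'' 0 (int l + 1) s3)"
          using inv out3 by (subst verdict_cong[where s = s1]) auto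
        ultimately show "runs rounds H Skip s3 (\<lambda>s2. ?Inv (Suc l) (put ''l'' 0 (int l + 1) s2))"
          by (intro runs_Skip) (auto elim!: verdict_weaken simp: less_Suc_eq)
      qed
    qed
  next
    show "?Inv 0 (put ''l'' 0 0 s)"
      using out by (simp add: verdict_def decode_answer_def)
  qed (auto simp: counts)
qed

end

section \<open>Correctness of the program\<close>

text \<open>The value that \<open>find_pivot\<close> leaves in \<open>c\<close>; the default 0 is
  never mistaken for a pivot, as a row with a nonzero entry is searched.\<close>

primrec last_index :: "(nat \<Rightarrow> bool) \<Rightarrow> nat \<Rightarrow> nat" where
  "last_index P 0 = 0"
| "last_index P (Suc i) = (if P i then i else last_index P i)"

lemma last_index_le: "last_index P i \<le> i"
  by (induction i) auto

lemma last_index: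
  assumes "\<exists>j<i. P j"
  shows "P (last_index P i) \<and> last_index P i < i"
  using assms by (induction i) (auto simp: less_Suc_eq)

context sep_problem
begin

section \<open>Running the elimination\<close>

definition A :: "nat \<Rightarrow> nat \<Rightarrow> int" where
  "A l j = of_bool (j \<in> family I ! l)"

definition entries :: "memory \<Rightarrow> nat \<Rightarrow> nat \<Rightarrow> int" where
  "entries s i j = s ''M'' (int (i * n + j))"

text \<open>\<open>B\<close> is never stored: it only certifies the size and exactness of the
  entries. The pivot columns \<open>C\<close> are stored, since \<open>span_test\<close> reads
  them.\<close>

definition eliminated :: "nat \<Rightarrow> memory \<Rightarrow> bool" where
  "eliminated r s \<longleftrightarrow> (\<exists>B. reduced k n A B (s ''D'' 0) (entries s)) \<and>
     (\<exists>C. pivots r k n C (s ''D'' 0) (entries s) \<and> (\<forall>l<r. s ''C'' (int l) = int (C l)))"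

lemma eliminated_cong:
  "s' ''M'' = s ''M'' \<Longrightarrow> s' ''D'' = s ''D'' \<Longrightarrow> s' ''C'' = s ''C'' \<Longrightarrow> eliminated r s' = eliminated r s"
  by (simp add: eliminated_def entries_def[abs_def])

lemma independent: "independent_family (family I)"
  using valid by (simp add: valid_instance_def)

text \<open>\<open>k * fact k\<close> is at most \<open>k ^ Suc k\<close>; with
  \<open>k \<le> 2 ^ L\<close> and \<open>Suc k \<le> L\<close> this gives the exponent
  \<open>L * L\<close>.\<close>

lemma reduced_le:
  assumes "reduced k n A B D M" "i < k" "j < n"
  shows "\<bar>M i j\<bar> \<le> 2 ^ (L * L)"
proof -
  have "\<bar>M i j\<bar> \<le> int k * fact k"
    by (rule reduced_bound[OF assms]) (simp add: A_def)
  also have "\<dots> = int (k * fact k)" by simp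
  also have "k * fact k \<le> k * k ^ k" using fact_le_power[of k, where 'a = nat] by (intro mult_left_mono) auto
  also have "int (k * k ^ k) = int k ^ Suc k" by simp
  also have "\<dots> \<le> (2 ^ L) ^ Suc k"
    using n_le_power k_le by (intro power_mono) auto
  also have "\<dots> \<le> (2 ^ L) ^ L" using k_less by (intro power_increasing) auto
  finally show ?thesis by (simp add: power_mult)
qed

lemma reduced_le_H:
  assumes "reduced k n A B D M" "i < k" "j < n"
  shows "\<bar>M i j\<bar> \<le> H"
proof -
  have "(2 :: int) ^ (L * L) \<le> H"
    by (rule power_le_H, rule trans_le_add2, rule mult_left_mono) auto
  with reduced_le[OF assms] show ?thesis by linarith
qed

lemma index_less: "a < k * n \<Longrightarrow> a div n < k" "a < k * n \<Longrightarrow> a mod n < n"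
  using n_pos by (auto simp: less_mult_imp_div_less)

lemma runs_elimination_init:
  assumes s: "loaded s"
  shows "runs rounds H (init_matrix m) s (eliminated 0)"
  unfolding init_matrix_def
proof (rule runs_Seq)
  show "runs rounds H (Fill ''M'' 0 ''i'' (Mul kE nE) (In (Family m (Const 0) (Var ''i'')))) s (\<lambda>s'.
      (\<forall>i<k * n. s' ''M'' (int (0 + i)) = A (i div n) (i mod n)) \<and>
      (\<forall>j. j < int 0 \<or> j \<ge> int (0 + k * n) \<longrightarrow> s' ''M'' j = s ''M'' j))"
  proof (rule runs_Fill)
    fix s' assume "agree {''i'', ''M''} s s'"
    then have "loaded s'" using s by (simp add: loaded_def)
    then show "val (Mul kE nE) s' = int (k * n)" by (simp add: val_nk)
  next
    fix i s' assume i: "i < k * n" and a: "agree {''i'', ''M''} s s'" "s' ''i'' 0 = int i"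
    then have s': "loaded s'" using s by (simp add: loaded_def)
    have "family_pos 0 i = family_pos (i div n) (i mod n)" by (simp add: family_pos_def)
    then have "val (Family m (Const 0) (Var ''i'')) s' = int (family_pos (i div n) (i mod n))"
      using val_positions(3)[OF s', of "Const 0" 0 "Var ''i''" i] a by simp
    then show "val (In (Family m (Const 0) (Var ''i''))) s' = A (i div n) (i mod n)"
      using loaded_nth[OF s' family_at(1)] family_at(2) index_less[OF i] by (simp add: A_def)
  qed (use one_le_H in \<open>simp_all add: counts A_def\<close>)
  fix s' assume M: "(\<forall>i<k * n. s' ''M'' (int (0 + i)) = A (i div n) (i mod n)) \<and>
      (\<forall>j. j < int 0 \<or> j \<ge> int (0 + k * n) \<longrightarrow> s' ''M'' j = s ''M'' j)"
  have "entries s' i j = A i j" if "i < k" "j < n" for i j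
    using M matrix_pos_less[OF that] that by (auto simp: entries_def simp del: of_nat_add of_nat_mult)
  then have "reduced k n A (1\<^sub>m k) 1 (entries s')"
    using reduced_init[of k n A] by (simp add: reduced_def)
  then have "eliminated 0 (put ''D'' 0 1 s')"
    by (auto simp: eliminated_def pivots_def entries_def[abs_def])
  then show "runs rounds H (Write ''D'' (Const 0) (Const 1)) s' (eliminated 0)"
    by (intro runs_Write) (simp_all add: one_le_H)
qed

lemma runs_elimination_round:
  assumes s: "loaded s" and r: "r < k" "s ''r'' 0 = int r" and el: "eliminated r s"
  shows "runs rounds H elimination_round s (eliminated (Suc r))"
proof -
  let ?M = "entries s" and ?D = "s ''D'' 0"
  obtain B C where red: "reduced k n A B ?D ?M" and piv: "pivots r k n C ?D ?M"
    and C: "\<forall>l<r. s ''C'' (int l) = int (C l)"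
    using el unfolding eliminated_def by blast
  have D: "?D \<noteq> 0" using red by (simp add: reduced_def)
  define c where "c = last_index (\<lambda>j. ?M r j \<noteq> 0) n"
  have "\<exists>j<n. ?M r j \<noteq> 0"
  proof (rule reduced_row_nonzero[OF red r(1)])
    fix y :: "nat \<Rightarrow> int" assume "\<And>j. j < n \<Longrightarrow> (\<Sum>i<k. y i * A i j) = 0"
    then show "\<forall>i<k. y i = 0"
      using independent_family_rows[OF independent, of n y] family_subset
      by (simp add: A_def k_def in_set_conv_nth) (metis in_set_conv_nth)
  qed
  from last_index[OF this] have nz: "?M r c \<noteq> 0" and c: "c < n" by (auto simp: c_def)
  define M' where "M' i j = (?M r c * ?M i j - (?M i c - (if i = r then ?D else 0)) * ?M r j) div ?D" for i j
  have A1: "\<bar>A i c\<bar> \<le> 1" for i by (simp add: A_def)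
  note step = reduced_pivot[OF red r(1) c nz A1]
  \<comment> \<open>The new entries have to fit before they are written. They form a reduced matrix
    again, so the general bound applies to them; the larger numerators occur only inside an
    expression.\<close>
  have M'_le: "\<bar>M' i j\<bar> \<le> H" if "i < k" "j < n" for i j
  proof -
    have "\<exists>B'. reduced k n A B' (?M r c) M'" by (rule step(1)) (simp add: M'_def)
    then show ?thesis using reduced_le_H that by blast
  qed
  let ?p1 = "Write ''c'' (Const 0) (Const 0)" and ?p3 = "Write ''C'' (Var ''r'') (Var ''c'')"
    and ?p5 = "Write ''D'' (Const 0) (Entry (Var ''r'') (Var ''c''))"
    and ?p6 = "Fill ''M'' 0 ''i'' (Mul kE nE) (Read ''M2'' (Var ''i''))"
  show ?thesis
    unfolding elimination_round_def
  proof (rule runs_Seq)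
    show "runs rounds H ?p1 s (\<lambda>s'. s' ''c'' 0 = 0)"
      using one_le_H by (intro runs_Write) auto
    fix s1 assume a1: "agree (writes ?p1) s s1" and c1: "s1 ''c'' 0 = 0"
    show "runs rounds H (Seq find_pivot (Seq ?p3 (Seq pivot_step (Seq ?p5 ?p6)))) s1 (eliminated (Suc r))"
    proof (rule runs_Seq)
      show "runs rounds H find_pivot s1 (\<lambda>s'. s' ''c'' 0 = int (last_index (\<lambda>j. ?M r j \<noteq> 0) n))"
        unfolding find_pivot_def
      proof (rule runs_Accumulate[where F = "\<lambda>i. int (last_index (\<lambda>j. ?M r j \<noteq> 0) i)"])
        fix s' assume "agree {''i'', ''c''} s1 s'"
        then have "loaded s'" using s a1 by (simp add: loaded_def)
        then show "val nE s' = int n" by (simp add: val_nk)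
      next
        fix i s' assume "i < n" and a: "agree {''i'', ''c''} s1 s'" "s' ''i'' 0 = int i"
          and ci: "s' ''c'' 0 = int (last_index (\<lambda>j. ?M r j \<noteq> 0) i)"
        then have s': "loaded s'" "s' ''r'' 0 = int r" "s' ''M'' = s ''M''"
          using s a1 r by (simp_all add: loaded_def)
        then show "val (Add (Var ''c'')
             (Mul (Complement (Eq (Entry (Var ''r'') (Var ''i'')) (Const 0))) (Sub (Var ''i'') (Var ''c'')))) s' =
             int (last_index (\<lambda>j. ?M r j \<noteq> 0) (Suc i))"
          using a(2) ci by (simp add: val_nk entries_def)
      next
        fix i assume "i \<le> n"
        then have "int (last_index (\<lambda>j. ?M r j \<noteq> 0) i) \<le> int n"
          using last_index_le[of "\<lambda>j. ?M r j \<noteq> 0" i] by simp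
        then show "\<bar>int (last_index (\<lambda>j. ?M r j \<noteq> 0) i)\<bar> \<le> H"
          using int_le_H[OF n_count] by simp
      qed (use c1 in \<open>simp_all add: counts\<close>)
      fix s2 assume a2: "agree (writes find_pivot) s1 s2" and c2: "s2 ''c'' 0 = int (last_index (\<lambda>j. ?M r j \<noteq> 0) n)"
      have r2: "s2 ''r'' 0 = int r" using a2 a1 r by simp
      show "runs rounds H (Seq ?p3 (Seq pivot_step (Seq ?p5 ?p6))) s2 (eliminated (Suc r))"
      proof (rule runs_Seq)
        show "runs rounds H ?p3 s2 (\<lambda>s'. s' ''C'' = (s ''C'')(int r := int c))"
          using r2 c2 a1 a2 c int_le_H[OF n_count] by (intro runs_Write) (auto simp: c_def)
        fix s3 assume a3: "agree (writes ?p3) s2 s3" and C3: "s3 ''C'' = (s ''C'')(int r := int c)"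
        have c3: "s3 ''c'' 0 = int c" using a3 c2 by (simp add: c_def)
        have s3: "loaded s3" "s3 ''r'' 0 = int r" "s3 ''M'' = s ''M''" "s3 ''D'' = s ''D''"
          using a1 a2 a3 s r by (simp_all add: loaded_def)
        show "runs rounds H (Seq pivot_step (Seq ?p5 ?p6)) s3 (eliminated (Suc r))"
        proof (rule runs_Seq)
          show "runs rounds H pivot_step s3 (\<lambda>s'.
             (\<forall>i<k * n. s' ''M2'' (int (0 + i)) = M' (i div n) (i mod n)) \<and>
             (\<forall>j. j < int 0 \<or> j \<ge> int (0 + k * n) \<longrightarrow> s' ''M2'' j = s3 ''M2'' j))"
            unfolding pivot_step_def
          proof (rule runs_Fill)
            fix s' assume "agree {''i'', ''M2''} s3 s'"
            then have "loaded s'" using s3 by (simp add: loaded_def)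
            then show "val (Mul kE nE) s' = int (k * n)" by (simp add: val_nk)
          next
            fix i s' assume i: "i < k * n" and a: "agree {''i'', ''M2''} s3 s'" "s' ''i'' 0 = int i"
            then have s': "loaded s'" "s' ''r'' 0 = int r" "s' ''c'' 0 = int c" "s' ''M'' = s ''M''" "s' ''D'' = s ''D''"
              using s3 c3 by (simp_all add: loaded_def)
            have "s ''M'' (int i) = ?M (i div n) (i mod n)" by (simp add: entries_def)
            then show "val (Div (Sub (Mul (Entry (Var ''r'') (Var ''c'')) (Read ''M'' (Var ''i'')))
                       (Mul (Sub (Entry (Div (Var ''i'') nE) (Var ''c''))
                                 (Mul (Eq (Div (Var ''i'') nE) (Var ''r'')) (Var ''D'')))
                            (Entry (Var ''r'') (Mod (Var ''i'') nE))))
                  (Var ''D'')) s' = M' (i div n) (i mod n)"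
              using a(2) s' by (simp add: val_nk M'_def entries_def flip: zdiv_int zmod_int)
          qed (use M'_le index_less in \<open>simp_all add: counts\<close>)
          fix s4 assume a4: "agree (writes pivot_step) s3 s4"
            and "(\<forall>i<k * n. s4 ''M2'' (int (0 + i)) = M' (i div n) (i mod n)) \<and>
             (\<forall>j. j < int 0 \<or> j \<ge> int (0 + k * n) \<longrightarrow> s4 ''M2'' j = s3 ''M2'' j)"
          then have M2: "\<forall>i<k * n. s4 ''M2'' (int i) = M' (i div n) (i mod n)" by simp
          have s4: "loaded s4" "s4 ''r'' 0 = int r" "s4 ''c'' 0 = int c" "s4 ''M'' = s ''M''"
            "s4 ''C'' = (s ''C'')(int r := int c)"
            using a4 s3 c3 C3 by (simp_all add: loaded_def)
          show "runs rounds H (Seq ?p5 ?p6) s4 (eliminated (Suc r))"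
          proof (rule runs_Seq)
            have v: "val (Entry (Var ''r'') (Var ''c'')) s4 = ?M r c"
              using s4 by (simp add: val_nk entries_def)
            show "runs rounds H ?p5 s4 (\<lambda>s'. s' ''D'' 0 = ?M r c)"
              by (rule runs_Write, unfold v) (use reduced_le_H[OF red r(1) c] in simp_all)
            fix s5 assume a5: "agree (writes ?p5) s4 s5" and D5: "s5 ''D'' 0 = ?M r c"
            have s5: "loaded s5" "s5 ''C'' = (s ''C'')(int r := int c)"
              and M25: "\<forall>i<k * n. s5 ''M2'' (int i) = M' (i div n) (i mod n)"
              using a5 s4 M2 by (simp_all add: loaded_def)
            show "runs rounds H ?p6 s5 (eliminated (Suc r))"
            proof (rule runs_conseq)
              show "runs rounds H ?p6 s5 (\<lambda>s'.
                (\<forall>i<k * n. s' ''M'' (int (0 + i)) = M' (i div n) (i mod n)) \<and>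
                (\<forall>j. j < int 0 \<or> j \<ge> int (0 + k * n) \<longrightarrow> s' ''M'' j = s5 ''M'' j))"
              proof (rule runs_Fill)
                fix s' assume "agree {''i'', ''M''} s5 s'"
                then have "loaded s'" using s5 by (simp add: loaded_def)
                then show "val (Mul kE nE) s' = int (k * n)" by (simp add: val_nk)
              qed (use M'_le index_less M25 in \<open>simp_all add: counts\<close>)
              fix s6 assume a6: "agree (writes ?p6) s5 s6"
                and M6: "(\<forall>i<k * n. s6 ''M'' (int (0 + i)) = M' (i div n) (i mod n)) \<and>
                (\<forall>j. j < int 0 \<or> j \<ge> int (0 + k * n) \<longrightarrow> s6 ''M'' j = s5 ''M'' j)"
              have e6: "entries s6 i j = M' i j" if "i < k" "j < n" for i j
                using M6 matrix_pos_less[OF that] that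
                by (auto simp: entries_def simp del: of_nat_add of_nat_mult)
              have d6: "s6 ''D'' 0 = ?M r c" and C6: "s6 ''C'' = (s ''C'')(int r := int c)"
                using a6 D5 s5 by simp_all
              \<comment> \<open>The pivot lemma is applied again, now to the stored entries, which
                are known to agree with \<open>M'\<close> only for rows below \<open>k\<close> and
                columns below \<open>n\<close>.\<close>
              have step6: "\<exists>B'. reduced k n A B' (?M r c) (entries s6)"
                "\<And>i j. i < k \<Longrightarrow> j < n \<Longrightarrow>
                  ?D * entries s6 i j = ?M r c * ?M i j - (?M i c - (if i = r then ?D else 0)) * ?M r j"
                using step[of "entries s6"] e6 by (simp_all add: M'_def)
              have "pivots (Suc r) k n (C(r := c)) (?M r c) (entries s6)"
                by (rule pivots_step[OF piv r(1) c D step6(2)])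
              moreover have "\<forall>l<Suc r. s6 ''C'' (int l) = int ((C(r := c)) l)"
                using C C6 by (auto simp: less_Suc_eq)
              ultimately show "eliminated (Suc r) s6"
                unfolding eliminated_def d6 using step6(1) by blast
            qed
          qed
        qed
      qed
    qed
  qed
qed

lemma runs_elimination:
  assumes s: "loaded s"
  shows "runs rounds H (elimination m) s (eliminated k)"
  unfolding elimination_def
proof (rule runs_Seq[OF runs_elimination_init[OF s]])
  fix s1 assume "agree (writes (init_matrix m)) s s1" and el: "eliminated 0 s1"
  then have s1: "loaded s1" using s by (simp add: loaded_def)
  show "runs rounds H (For ''r'' kE elimination_round) s1 (eliminated k)"
  proof (rule runs_For)
    fix s' assume "agree (insert ''r'' (writes elimination_round)) s1 s'"
    then show "val kE s' = int k" using s1 by (simp add: loaded_def val_nk)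
  next
    show "eliminated 0 (put ''r'' 0 0 s1)" using el by (subst eliminated_cong[of _ s1]) auto
  next
    fix r s' assume r: "r < k" and a: "agree (insert ''r'' (writes elimination_round)) s1 s'"
      and "s' ''r'' 0 = int r" "eliminated r s'"
    then have "loaded s'" using s1 by (simp add: loaded_def)
    then have "runs rounds H elimination_round s' (eliminated (Suc r))"
      by (rule runs_elimination_round) fact+
    then show "runs rounds H elimination_round s' (\<lambda>s''. eliminated (Suc r) (put ''r'' 0 (int r + 1) s''))"
      by (rule runs_conseq) (subst eliminated_cong, auto)
  qed (simp_all add: counts)
qed

lemma eliminated_span_iff:
  assumes "eliminated k s"
  obtains C where "\<And>r. r < k \<Longrightarrow> C r < n" "\<And>r. r < k \<Longrightarrow> s ''C'' (int r) = int (C r)"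
    "\<And>r j. r < k \<Longrightarrow> j < n \<Longrightarrow> \<bar>entries s r j\<bar> \<le> 2 ^ (L * L)"
    "\<And>S. S \<subseteq> {..<n} \<Longrightarrow> char_vec S \<in> coord.span (char_vec ` set (family I)) \<longleftrightarrow>
      (\<forall>j<n. (\<Sum>r<k. of_bool (C r \<in> S) * entries s r j) = s ''D'' 0 * of_bool (j \<in> S))"
proof -
  obtain B C where red: "reduced k n A B (s ''D'' 0) (entries s)"
    and piv: "pivots k k n C (s ''D'' 0) (entries s)" and C: "\<forall>l<k. s ''C'' (int l) = int (C l)"
    using assms unfolding eliminated_def by blast
  show thesis
  proof (rule that)
    show "C r < n" if "r < k" for r using piv that by (simp add: pivots_def)
    show "s ''C'' (int r) = int (C r)" if "r < k" for r using C that by simp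
    show "\<bar>entries s r j\<bar> \<le> 2 ^ (L * L)" if "r < k" "j < n" for r j
      using reduced_le[OF red that] .
    show "char_vec S \<in> coord.span (char_vec ` set (family I)) \<longleftrightarrow>
      (\<forall>j<n. (\<Sum>r<k. of_bool (C r \<in> S) * entries s r j) = s ''D'' 0 * of_bool (j \<in> S))"
      if "S \<subseteq> {..<n}" for S
      unfolding k_def
    proof (rule reduced_span_iff)
      show "reduced (length (family I)) n (\<lambda>l j. of_bool (j \<in> family I ! l)) B (s ''D'' 0) (entries s)"
        using red by (simp add: A_def[abs_def] k_def)
      show "pivots (length (family I)) (length (family I)) n C (s ''D'' 0) (entries s)"
        using piv by (simp add: k_def)
      show "distinct (family I)" using independent by (simp add: independent_family_def)
      show "\<forall>S\<in>set (family I). S \<subseteq> {..<n}" using valid by (simp add: valid_instance_def n_def)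
    qed fact
  qed
qed

section \<open>Enumeration of the coalitions to be tested\<close>

definition W :: "nat \<Rightarrow> nat \<Rightarrow> int" where
  "W u = weight m (\<lambda>i j. scaled (profit I i j)) (\<lambda>i j. scaled (demand I i j))
     (\<lambda>i. \<Delta> * scaled (point I i)) (digit n u)"

definition cand :: "nat \<Rightarrow> nat set" where
  "cand t = candidate n (digit n (t div (n + 1)) ` {..<m}) (W (t div (n + 1))) (t mod (n + 1))"

definition violating :: "nat \<Rightarrow> bool" where
  "violating t \<longleftrightarrow> char_vec (cand t) \<notin> coord.span (char_vec ` set (family I)) \<and>
     (\<Sum>i\<in>cand t. W (t div (n + 1)) i) < \<Delta> * scaled (level I)"

lemma cand_subset: "cand t \<subseteq> {..<n}"
  by (auto simp: cand_def candidate_def)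

lemma W_le: "i < n \<Longrightarrow> \<bar>W u i\<bar> \<le> 2 ^ (m + 4 * L)"
proof -
  assume i: "i < n"
  have "\<bar>\<Delta> * scaled (point I i)\<bar> \<le> 2 ^ L * 2 ^ (2 * L)"
    unfolding abs_mult using \<Delta>_pos \<Delta>_le scaled_rat_at(2)[OF rat_at_point[OF i]]
    by (intro mult_mono) auto
  also have "\<dots> = 2 ^ (3 * L)" by (simp flip: power_add)
  also have "\<dots> \<le> (2 :: int) ^ (4 * L)" by (intro power_increasing) auto
  finally have x: "\<bar>\<Delta> * scaled (point I i)\<bar> \<le> 2 ^ (4 * L)" .
  have "\<bar>\<Sum>j<m. scaled (demand I i j) * scaled (profit I (digit n u j) j)\<bar> \<le> int m * 2 ^ (4 * L)"
  proof (rule abs_partial_sum_le)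
    fix j assume j: "j < m"
    have "\<bar>scaled (demand I i j) * scaled (profit I (digit n u j) j)\<bar> \<le> 2 ^ (2 * L) * 2 ^ (2 * L)"
      unfolding abs_mult
      using scaled_rat_at(2)[OF rat_at_demand[OF i j]]
        scaled_rat_at(2)[OF rat_at_profit[OF digit_less[OF n_pos] j]]
      by (intro mult_mono) auto
    also have "\<dots> = 2 ^ (4 * L)" by (simp flip: power_add)
    finally show "\<bar>scaled (demand I i j) * scaled (profit I (digit n u j) j)\<bar> \<le> 2 ^ (4 * L)" .
  qed simp
  with x have "\<bar>W u i\<bar> \<le> (1 + int m) * 2 ^ (4 * L)"
    unfolding W_def weight_def by (simp add: algebra_simps)
  also have "1 + int m \<le> 2 ^ m"
    using less_exp[of m] by (metis Suc_leI of_nat_Suc of_nat_le_iff of_nat_numeral of_nat_power)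
  finally show ?thesis by (simp add: power_add)
qed

lemma W_scaled:
  assumes i: "i < n"
  shows "real_of_int (W u i) = \<Delta> * (\<Delta> * weight m (\<lambda>i j. real_of_rat (profit I i j))
    (\<lambda>i j. real_of_rat (demand I i j)) (\<lambda>i. real_of_rat (point I i)) (digit n u) i)"
proof -
  have "real_of_int (W u i) = \<Delta> * (\<Delta> * of_rat (point I i)) -
    (\<Sum>j<m. (\<Delta> * of_rat (demand I i j)) * (\<Delta> * of_rat (profit I (digit n u j) j)))"
    unfolding W_def weight_def
    using i digit_less[OF n_pos] by (simp add: scaled_point scaled_demand scaled_profit)
  then show ?thesis by (simp add: weight_def right_diff_distrib sum_distrib_left mult_ac)
qed

lemma sum_W_less_iff:
  assumes S: "S \<subseteq> {..<n}"
  shows "(\<Sum>i\<in>S. W u i) < \<Delta> * scaled (level I) \<longleftrightarrow>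
    (\<Sum>i\<in>S. weight m (\<lambda>i j. real_of_rat (profit I i j)) (\<lambda>i j. real_of_rat (demand I i j))
      (\<lambda>i. real_of_rat (point I i)) (digit n u) i) < real_of_rat (level I)" (is "_ \<longleftrightarrow> sum ?w S < _")
proof -
  have "real_of_int (\<Sum>i\<in>S. W u i) = (\<Sum>i\<in>S. \<Delta> * (\<Delta> * ?w i))"
    unfolding of_int_sum using S by (intro sum.cong) (auto simp: W_scaled)
  also have "\<dots> = \<Delta> * (\<Delta> * sum ?w S)" by (simp add: sum_distrib_left)
  finally have "(\<Sum>i\<in>S. W u i) < \<Delta> * scaled (level I) \<longleftrightarrow>
      \<Delta> * (\<Delta> * sum ?w S) < \<Delta> * (\<Delta> * of_rat (level I))"
    unfolding scaled_level[symmetric] by (metis of_int_less_iff of_int_mult)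
  also have "\<dots> \<longleftrightarrow> sum ?w S < of_rat (level I)" using \<Delta>_pos by simp
  finally show ?thesis .
qed

lemma satisfied_Inequality:
  "satisfied (Inequality S) \<longleftrightarrow> real_of_rat (level I) \<le> (\<Sum>i\<in>S. real_of_rat (point I i)) -
    game_value m (\<lambda>i j. real_of_rat (profit I i j)) (\<lambda>i j. real_of_rat (demand I i j)) S"
  by (auto simp: satisfied_def inst_value_def inst_point_def)

lemma char_vec_empty: "char_vec {} \<in> coord.span X"
proof -
  have "(char_vec {} :: nat \<Rightarrow> real) = 0" by (rule ext) simp
  then show ?thesis by (simp only: coord.span_zero)
qed

text \<open>The empty coalition lies in every span, so the tested one is nonempty; it contains the
  chosen players, hence its excess is at most its weight, which is below the level.\<close>

lemma violating_sound:
  assumes "violating t"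
  shows "Inequality (cand t) \<in> lp_constraints n (family I)" "\<not> satisfied (Inequality (cand t))"
proof -
  have out: "char_vec (cand t) \<notin> coord.span (char_vec ` set (family I))"
    using assms by (simp add: violating_def)
  then show "Inequality (cand t) \<in> lp_constraints n (family I)"
    using cand_subset by (simp add: lp_constraints_def)
  let ?K = "digit n (t div (n + 1))"
  have "(\<Sum>i\<in>cand t. real_of_rat (point I i)) -
      game_value m (\<lambda>i j. of_rat (profit I i j)) (\<lambda>i j. of_rat (demand I i j)) (cand t) \<le>
    (\<Sum>i\<in>cand t. weight m (\<lambda>i j. of_rat (profit I i j)) (\<lambda>i j. of_rat (demand I i j))
      (\<lambda>i. of_rat (point I i)) ?K i)"
  proof (rule excess_le_weight)
    show "cand t \<noteq> {}" using out char_vec_empty by auto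
    show "finite (cand t)" using cand_subset finite_subset by blast
    show "?K j \<in> cand t" if "j < m" for j
      using that digit_less[OF n_pos] by (auto simp: cand_def candidate_def)
    show "0 \<le> real_of_rat (demand I i j)" if "i \<in> cand t" "j < m" for i j
      using that valid cand_subset by (auto simp: valid_instance_def n_def)
  qed
  also have "\<dots> < of_rat (level I)"
    using assms sum_W_less_iff[OF cand_subset] by (simp add: violating_def)
  finally show "\<not> satisfied (Inequality (cand t))" by (simp add: satisfied_Inequality)
qed

text \<open>For players attaining the maxima in \<open>S\<close>, the weight of \<open>S\<close> is
  its excess, and \<open>candidate_optimal\<close> supplies a coalition outside the span of no
  larger weight.\<close>

lemma violating_complete:
  assumes S: "S \<subseteq> {..<n}" and out: "char_vec S \<notin> coord.span (char_vec ` set (family I))"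
    and viol: "\<not> satisfied (Inequality S)"
  shows "\<exists>t<(n + 1) * n ^ m. violating t"
proof -
  have ne: "S \<noteq> {}" and fin: "finite S" using out char_vec_empty S finite_subset by auto
  let ?w = "weight m (\<lambda>i j. real_of_rat (profit I i j)) (\<lambda>i j. real_of_rat (demand I i j))
    (\<lambda>i. real_of_rat (point I i))"
  obtain K where K: "\<forall>j. K j \<in> S" and eq: "sum (?w K) S < real_of_rat (level I)"
    using excess_eq_weight[OF ne fin, of m "\<lambda>i j. real_of_rat (profit I i j)"
      "\<lambda>i j. real_of_rat (demand I i j)" "\<lambda>i. real_of_rat (point I i)"] viol
    by (auto simp: satisfied_Inequality)
  have "K j < n" for j using K S by auto
  then obtain u where u: "u < n ^ m" "\<forall>j<m. digit n u j = K j" using digits_surj by blast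
  have "?w (digit n u) = ?w K" using u(2) by (auto simp: weight_def)
  then have W: "(\<Sum>i\<in>S. W u i) < \<Delta> * scaled (level I)" using eq by (simp add: sum_W_less_iff[OF S])
  have "digit n u ` {..<m} \<subseteq> S" using K u(2) by auto
  from candidate_optimal[OF S this out, of "W u"]
  obtain f where f: "f \<le> n" and T: "char_vec (candidate n (digit n u ` {..<m}) (W u) f) \<notin> coord.span (char_vec ` set (family I))"
    "sum (W u) (candidate n (digit n u ` {..<m}) (W u) f) \<le> sum (W u) S" by blast
  \<comment> \<open>As \<open>f \<le> n\<close>, it is a proper remainder modulo
    \<open>n + 1\<close>, including the value \<open>n\<close> for no exchange.\<close>
  let ?t = "f + u * (n + 1)"
  have t: "?t div (n + 1) = u" "?t mod (n + 1) = f"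
    using f by (simp_all only: div_mult_self1 mod_mult_self1 div_less mod_less Suc_eq_plus1[symmetric]
      less_Suc_eq_le nat.simps add_0_right not_False_eq_True)
  have "violating ?t" unfolding violating_def cand_def t using T W by simp
  moreover have "?t < (n + 1) * n ^ m"
  proof -
    have "Suc u * (n + 1) \<le> n ^ m * (n + 1)" using u(1) by (intro mult_right_mono) auto
    then show ?thesis using f by (simp add: algebra_simps)
  qed
  ultimately show ?thesis by blast
qed

lemma val_Digit:
  assumes "loaded s" "s ''t'' 0 = int t"
  shows "val (Digit j) s = int (digit n (t div (n + 1)) j)"
proof -
  have "int t div (int n + 1) = int (t div (n + 1))" by (simp add: zdiv_int add.commute)
  then show ?thesis
    using assms by (simp add: Digit_def val_nk digit_def flip: of_nat_power zdiv_int zmod_int)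
qed

lemma runs_weights:
  assumes s: "ready s" "s ''t'' 0 = int t"
  shows "runs rounds H (compute_weights m) s (\<lambda>s'. \<forall>i<n. s' ''w'' (int i) = W (t div (n + 1)) i)"
  unfolding compute_weights_def
proof (rule runs_conseq)
  show "runs rounds H (Fill ''w'' 0 ''i'' nE
      (Sub (Mul (Var ''delta'') (Scaled (Point m (Var ''i''))))
        (Sum (\<lambda>j. Mul (Scaled (Demand m (Var ''i'') j)) (Scaled (Profit m (Digit j) j))) m))) s
      (\<lambda>s'. (\<forall>i<n. s' ''w'' (int (0 + i)) = W (t div (n + 1)) i) \<and>
      (\<forall>j. j < int 0 \<or> j \<ge> int (0 + n) \<longrightarrow> s' ''w'' j = s ''w'' j))"
  proof (rule runs_Fill)
    fix s' assume "agree {''i'', ''w''} s s'"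
    then show "val nE s' = int n" using s by (simp add: ready_def loaded_def val_nk)
  next
    fix i s' assume i: "i < n" and a: "agree {''i'', ''w''} s s'" "s' ''i'' 0 = int i"
    then have s': "ready s'" "loaded s'" "s' ''t'' 0 = int t" using s by (simp_all add: ready_def loaded_def)
    have "val (Scaled (Demand m (Var ''i'') j)) s' = scaled (demand I i j)"
      and "val (Scaled (Profit m (Digit j) j)) s' = scaled (profit I (digit n (t div (n + 1)) j) j)"
      if "j < m" for j
      using that i a(2) s'(1) val_Digit[OF s'(2,3)] digit_less[OF n_pos] by (auto intro!: val_inputs)
    moreover have "val (Scaled (Point m (Var ''i''))) s' = scaled (point I i)"
      using i a(2) s'(1) by (intro val_inputs) auto
    ultimately show "val (Sub (Mul (Var ''delta'') (Scaled (Point m (Var ''i''))))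
        (Sum (\<lambda>j. Mul (Scaled (Demand m (Var ''i'') j)) (Scaled (Profit m (Digit j) j))) m)) s' =
        W (t div (n + 1)) i"
      using s' by (simp add: W_def weight_def ready_def)
  next
    fix i assume "i < n"
    from W_le[OF this] have "\<bar>W (t div (n + 1)) i\<bar> \<le> 2 ^ (m + L * 4)" by (simp add: mult.commute)
    also have "\<dots> \<le> H" by (rule power_le_H, rule add_left_mono, rule mult_left_mono) auto
    finally show "\<bar>W (t div (n + 1)) i\<bar> \<le> H" .
  qed (simp_all add: counts)
qed simp

lemma runs_candidate:
  assumes s: "ready s" "s ''t'' 0 = int t" and w: "\<forall>i<n. s ''w'' (int i) = W (t div (n + 1)) i"
  shows "runs rounds H (compute_candidate m) s (\<lambda>s'. \<forall>i<n. s' ''S'' (int i) = of_bool (i \<in> cand t))"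
  unfolding compute_candidate_def
proof (rule runs_conseq)
  let ?e1 = "Complement (Eq (Sum (\<lambda>j. Eq (Var ''i'') (Digit j)) m) (Const 0))"
    and ?e2 = "Complement (Eq (Neg (Read ''w'' (Var ''i'')))
                  (Eq (Var ''i'') (Mod (Var ''t'') (Add nE (Const 1)))))"
  show "runs rounds H (Fill ''S'' 0 ''i'' nE (Or ?e1 ?e2)) s
      (\<lambda>s'. (\<forall>i<n. s' ''S'' (int (0 + i)) = of_bool (i \<in> cand t)) \<and>
      (\<forall>j. j < int 0 \<or> j \<ge> int (0 + n) \<longrightarrow> s' ''S'' j = s ''S'' j))"
  proof (rule runs_Fill)
    fix s' assume "agree {''i'', ''S''} s s'"
    then show "val nE s' = int n" using s by (simp add: ready_def loaded_def val_nk)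
  next
    fix i s' assume i: "i < n" and a: "agree {''i'', ''S''} s s'" "s' ''i'' 0 = int i"
    then have s': "loaded s'" "s' ''t'' 0 = int t" "s' ''w'' = s ''w''" using s by (simp_all add: ready_def loaded_def)
    let ?u = "t div (n + 1)"
    have "(\<Sum>j<m. of_bool (i = digit n ?u j) :: int) = 0 \<longleftrightarrow> (\<forall>j<m. i \<noteq> digit n ?u j)"
      by (subst sum_nonneg_eq_0_iff) auto
    then have e1: "val ?e1 s' = of_bool (i \<in> digit n ?u ` {..<m})"
      using a(2) val_Digit[OF s'(1,2)] by auto
    have "int t mod (int n + 1) = int (t mod (n + 1))" by (simp add: zmod_int add.commute)
    then have e2: "val ?e2 s' = of_bool (W ?u i < 0 \<longleftrightarrow> i \<noteq> t mod (n + 1))"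
      using a(2) s' w i val_nk[OF s'(1)] by (simp split: split_of_bool)
    show "val (Or ?e1 ?e2) s' = of_bool (i \<in> cand t)"
      unfolding val_Or[OF e1 e2] using i by (simp add: cand_def candidate_def)
  qed (use one_le_H in \<open>simp_all add: counts\<close>)
qed simp

lemma runs_outside:
  assumes s: "ready s" and el: "eliminated k s" and S: "\<forall>i<n. s ''S'' (int i) = of_bool (i \<in> S)"
    and sub: "S \<subseteq> {..<n}" and out: "s ''outside'' 0 = 0"
  shows "runs rounds H span_test s
    (\<lambda>s'. s' ''outside'' 0 = of_bool (char_vec S \<notin> coord.span (char_vec ` set (family I))))"
proof -
  obtain C where C: "\<And>r. r < k \<Longrightarrow> C r < n" "\<And>r. r < k \<Longrightarrow> s ''C'' (int r) = int (C r)"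
    and M: "\<And>r j. r < k \<Longrightarrow> j < n \<Longrightarrow> \<bar>entries s r j\<bar> \<le> 2 ^ (L * L)"
    and span: "\<And>S. S \<subseteq> {..<n} \<Longrightarrow> char_vec S \<in> coord.span (char_vec ` set (family I)) \<longleftrightarrow>
      (\<forall>j<n. (\<Sum>r<k. of_bool (C r \<in> S) * entries s r j) = s ''D'' 0 * of_bool (j \<in> S))"
    using eliminated_span_iff[OF el] by blast
  let ?g = "\<lambda>j r. of_bool (C r \<in> S) * entries s r j"
  let ?ne = "\<lambda>j. (\<Sum>r<k. ?g j r) \<noteq> s ''D'' 0 * of_bool (j \<in> S)"
  let ?sum = "Total ''sum'' ''i'' kE
      (Mul (Read ''S'' (Read ''C'' (Var ''i''))) (Entry (Var ''i'') (Var ''j'')))"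
    and ?wr = "Write ''outside'' (Const 0) (Or (Var ''outside'')
      (Complement (Eq (Var ''sum'') (Mul (Var ''D'') (Read ''S'' (Var ''j''))))))"
  have "runs rounds H span_test s (\<lambda>s'. s' ''outside'' 0 = of_bool (\<exists>j<n. ?ne j))"
    unfolding span_test_def
  proof (rule runs_For[where Inv = "\<lambda>i s'. s' ''outside'' 0 = of_bool (\<exists>j<i. ?ne j)"])
    fix s' assume "agree (insert ''j'' (writes (Seq ?sum ?wr))) s s'"
    then show "val nE s' = int n" using s by (simp add: ready_def loaded_def val_nk)
  next
    fix j s1 assume j: "j < n" and a1: "agree (insert ''j'' (writes (Seq ?sum ?wr))) s s1"
      and j1: "s1 ''j'' 0 = int j" and o1: "s1 ''outside'' 0 = of_bool (\<exists>i<j. ?ne i)"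
    have s1: "loaded s1" "s1 ''S'' = s ''S''" "s1 ''C'' = s ''C''" "s1 ''M'' = s ''M''" "s1 ''D'' = s ''D''"
      using a1 s by (simp_all add: ready_def loaded_def)
    show "runs rounds H (Seq ?sum ?wr) s1
        (\<lambda>s2. put ''j'' 0 (int j + 1) s2 ''outside'' 0 = of_bool (\<exists>i<Suc j. ?ne i))"
    proof (rule runs_Seq)
      show "runs rounds H ?sum s1 (\<lambda>s'. s' ''sum'' 0 = (\<Sum>r<k. ?g j r))"
      proof (rule runs_Total)
        fix s' assume "agree {''i'', ''sum''} s1 s'"
        then show "val kE s' = int k" using s1 by (simp add: loaded_def val_nk)
      next
        fix r s' assume r: "r < k" and a: "agree {''i'', ''sum''} s1 s'" "s' ''i'' 0 = int r"
        then have "loaded s'" "s' ''S'' = s ''S''" "s' ''C'' = s ''C''" "s' ''M'' = s ''M''" "s' ''j'' 0 = int j"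
          using s1 j1 by (simp_all add: loaded_def)
        then show "val (Mul (Read ''S'' (Read ''C'' (Var ''i''))) (Entry (Var ''i'') (Var ''j''))) s' = ?g j r"
          using a(2) r C S by (simp add: val_nk entries_def)
      next
        fix l assume "l \<le> k"
        then have "\<bar>\<Sum>r<l. ?g j r\<bar> \<le> int k * 2 ^ (L * L)"
          using M j by (intro abs_partial_sum_le) (auto simp: abs_mult)
        also have "\<dots> \<le> 2 ^ L * 2 ^ (L * L)"
          using n_le_power k_le by (intro mult_right_mono) auto
        also have "\<dots> = 2 ^ (L * (L + 1))" by (simp add: algebra_simps flip: power_add)
        also have "\<dots> \<le> H" by (rule power_le_H, rule trans_le_add2, rule mult_left_mono) auto
        finally show "\<bar>\<Sum>r<l. ?g j r\<bar> \<le> H" .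
      qed (simp_all add: counts)
      fix s2 assume a2: "agree (writes ?sum) s1 s2" and sum2: "s2 ''sum'' 0 = (\<Sum>r<k. ?g j r)"
      have "val (Var ''outside'') s2 = of_bool (\<exists>i<j. ?ne i)" using a2 o1 by simp
      moreover have "val (Complement (Eq (Var ''sum'') (Mul (Var ''D'') (Read ''S'' (Var ''j''))))) s2 = of_bool (?ne j)"
        using a2 sum2 s1 j1 j S by simp
      ultimately have v: "val (Or (Var ''outside'') (Complement (Eq (Var ''sum'') (Mul (Var ''D'') (Read ''S'' (Var ''j'')))))) s2
          = of_bool ((\<exists>i<j. ?ne i) \<or> ?ne j)" by (rule val_Or)
      show "runs rounds H ?wr s2
        (\<lambda>s2. put ''j'' 0 (int j + 1) s2 ''outside'' 0 = of_bool (\<exists>i<Suc j. ?ne i))"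
        by (rule runs_Write, unfold v) (use one_le_H in \<open>auto simp: less_Suc_eq\<close>)
    qed
  qed (use out in \<open>simp_all add: counts\<close>)
  then show ?thesis using span[OF sub] by simp
qed

lemma runs_enumeration_round:
  assumes s: "ready s" "s ''t'' 0 = int t" and el: "eliminated k s" and P: "verdict P s"
  shows "runs rounds H (enumeration_round m) s (verdict (P \<and> \<not> violating t))"
  unfolding enumeration_round_def
proof (rule runs_Seq[OF runs_weights[OF s]])
  let ?u = "t div (n + 1)"
  let ?p4 = "Write ''outside'' (Const 0) (Const 0)"
    and ?p6 = "IfPos (Mul (Var ''outside'') (Neg (Sub (Var ''acc'') (Mul (Var ''delta'') (Scaled (Level m))))))
       (report 1 (Read ''S'' (Var ''i''))) Skip"
  let ?g = "\<lambda>i. of_bool (i \<in> cand t) * W ?u i"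
  fix s1 assume a1: "agree (writes (compute_weights m)) s s1" and w1: "\<forall>i<n. s1 ''w'' (int i) = W ?u i"
  have s1: "ready s1" "s1 ''t'' 0 = int t" using a1 s by (simp_all add: ready_def loaded_def)
  show "runs rounds H (Seq (compute_candidate m) (Seq compute_total (Seq ?p4 (Seq span_test ?p6)))) s1 (verdict (P \<and> \<not> violating t))"
  proof (rule runs_Seq[OF runs_candidate[OF s1 w1]])
    fix s2 assume a2: "agree (writes (compute_candidate m)) s1 s2" and S2: "\<forall>i<n. s2 ''S'' (int i) = of_bool (i \<in> cand t)"
    have s2: "ready s2" "\<forall>i<n. s2 ''w'' (int i) = W ?u i" using a2 s1 w1 by (simp_all add: ready_def loaded_def)
    show "runs rounds H (Seq compute_total (Seq ?p4 (Seq span_test ?p6))) s2 (verdict (P \<and> \<not> violating t))"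
    proof (rule runs_Seq)
      show "runs rounds H compute_total s2 (\<lambda>s'. s' ''acc'' 0 = (\<Sum>i<n. ?g i))"
        unfolding compute_total_def
      proof (rule runs_Total)
        fix s' assume "agree {''i'', ''acc''} s2 s'"
        then show "val nE s' = int n" using s2 by (simp add: ready_def loaded_def val_nk)
      next
        fix i s' assume "i < n" "agree {''i'', ''acc''} s2 s'" "s' ''i'' 0 = int i"
        then show "val (Mul (Read ''S'' (Var ''i'')) (Read ''w'' (Var ''i''))) s' = ?g i"
          using s2 S2 by simp
      next
        fix l assume "l \<le> n"
        then have "\<bar>\<Sum>i<l. ?g i\<bar> \<le> int n * 2 ^ (m + 4 * L)"
          using W_le by (intro abs_partial_sum_le) (auto simp: abs_mult)
        also have "\<dots> \<le> 2 ^ L * 2 ^ (m + 4 * L)" by (intro mult_right_mono n_le_power) auto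
        also have "\<dots> = 2 ^ (m + L * 5)" by (simp add: algebra_simps flip: power_add)
        also have "\<dots> \<le> H" by (rule power_le_H, rule add_left_mono, rule mult_left_mono) auto
        finally show "\<bar>\<Sum>i<l. ?g i\<bar> \<le> H" .
      qed (simp_all add: counts)
      fix s3 assume a3: "agree (writes compute_total) s2 s3" and "s3 ''acc'' 0 = (\<Sum>i<n. ?g i)"
      then have acc3: "s3 ''acc'' 0 = (\<Sum>i\<in>cand t. W ?u i)"
        by (simp only: sum_eq_sum_of_bool[OF cand_subset])
      have s3: "ready s3" "\<forall>i<n. s3 ''S'' (int i) = of_bool (i \<in> cand t)"
        using a3 s2 S2 by (simp_all add: ready_def loaded_def)
      show "runs rounds H (Seq ?p4 (Seq span_test ?p6)) s3 (verdict (P \<and> \<not> violating t))"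
      proof (rule runs_Seq)
        show "runs rounds H ?p4 s3 (\<lambda>s'. s' ''outside'' 0 = 0)"
          using one_le_H by (intro runs_Write) auto
        fix s4 assume a4: "agree (writes ?p4) s3 s4" and o4: "s4 ''outside'' 0 = 0"
        have s4: "ready s4" "\<forall>i<n. s4 ''S'' (int i) = of_bool (i \<in> cand t)"
          "s4 ''acc'' 0 = (\<Sum>i\<in>cand t. W ?u i)"
          using a4 s3 acc3 by (simp_all add: ready_def loaded_def)
        have el4: "eliminated k s4" using el a1 a2 a3 a4 by (subst eliminated_cong[where s = s]) auto
        show "runs rounds H (Seq span_test ?p6) s4 (verdict (P \<and> \<not> violating t))"
        proof (rule runs_Seq[OF runs_outside[OF s4(1) el4 s4(2) cand_subset o4]])
          fix s5 assume a5: "agree (writes span_test) s4 s5" and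
            o5: "s5 ''outside'' 0 = of_bool (char_vec (cand t) \<notin> coord.span (char_vec ` set (family I)))"
          have s5: "ready s5" "\<forall>i<n. s5 ''S'' (int i) = of_bool (i \<in> cand t)"
            "s5 ''acc'' 0 = (\<Sum>i\<in>cand t. W ?u i)"
            using a5 s4 by (simp_all add: ready_def loaded_def)
          have out5: "s5 ''out'' = s ''out''" using a1 a2 a3 a4 a5 by simp
          \<comment> \<open>Both factors are truth values, so the product is the conjunction in
            \<open>violating\<close>.\<close>
          have "val (Mul (Var ''outside'') (Neg (Sub (Var ''acc'') (Mul (Var ''delta'') (Scaled (Level m)))))) s5
              = of_bool (violating t)"
            using o5 s5 val_inputs(5)[OF s5(1)] by (simp add: violating_def ready_def)
          then have test: "val (Mul (Var ''outside'') (Neg (Sub (Var ''acc'') (Mul (Var ''delta'') (Scaled (Level m)))))) s5 > 0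
              \<longleftrightarrow> violating t" by simp
          show "runs rounds H ?p6 s5 (verdict (P \<and> \<not> violating t))"
          proof (rule runs_IfPos, unfold test)
            assume viol: "violating t"
            show "runs rounds H (report 1 (Read ''S'' (Var ''i''))) s5 (verdict (P \<and> \<not> violating t))"
            proof (rule runs_conseq)
              show "runs rounds H (report 1 (Read ''S'' (Var ''i''))) s5 (\<lambda>s'. decode_answer n s' =
                  Some (if 1 = (1::int) then Inequality (cand t) else Equality (cand t)))"
                by (rule runs_report) (use s5 cand_subset in \<open>auto simp: ready_def\<close>)
              fix s6 assume "decode_answer n s6 =
                  Some (if 1 = (1::int) then Inequality (cand t) else Equality (cand t))"
              then show "verdict (P \<and> \<not> violating t) s6"
                using violating_sound[OF viol] by (intro verdict_violated) auto
            qed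
          next
            assume "\<not> violating t"
            moreover have "verdict P s5" using P out5 by (subst verdict_cong[where s = s])
            ultimately show "runs rounds H Skip s5 (verdict (P \<and> \<not> violating t))"
              by (intro runs_Skip) simp
          qed
        qed
      qed
    qed
  qed
qed

lemma runs_enumeration:
  assumes s: "ready s" and el: "eliminated k s" and P: "verdict P s"
  shows "runs rounds H (enumeration m) s (verdict (P \<and> (\<forall>t<(n + 1) * n ^ m. \<not> violating t)))"
  unfolding enumeration_def
proof (rule runs_For[where Inv = "\<lambda>i. verdict (P \<and> (\<forall>t<i. \<not> violating t))" and cnt = "(n + 1) * n ^ m"])
  fix s' assume "agree (insert ''t'' (writes (enumeration_round m))) s s'"
  then have "loaded s'" using s by (simp add: ready_def loaded_def)
  then show "val (Mul (Add nE (Const 1)) (Pow nE m)) s' = int ((n + 1) * n ^ m)"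
    by (simp add: val_nk algebra_simps)
next
  show "verdict (P \<and> (\<forall>t<0. \<not> violating t)) (put ''t'' 0 0 s)"
    using P by (subst verdict_cong[where s = s]) auto
next
  fix t s' assume t: "s' ''t'' 0 = int t" and v: "verdict (P \<and> (\<forall>t'<t. \<not> violating t')) s'"
    and a: "agree (insert ''t'' (writes (enumeration_round m))) s s'"
  then have "ready s'" using s by (simp add: ready_def loaded_def)
  moreover have "eliminated k s'" using a el by (subst eliminated_cong[of s' s]) auto
  ultimately have "runs rounds H (enumeration_round m) s'
      (verdict ((P \<and> (\<forall>t'<t. \<not> violating t')) \<and> \<not> violating t))"
    using t v by (intro runs_enumeration_round)
  then show "runs rounds H (enumeration_round m) s'
      (\<lambda>s''. verdict (P \<and> (\<forall>t'<Suc t. \<not> violating t')) (put ''t'' 0 (int t + 1) s''))"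
  proof (rule runs_conseq)
    fix s'' assume "verdict ((P \<and> (\<forall>t'<t. \<not> violating t')) \<and> \<not> violating t) s''"
    then have "verdict (P \<and> (\<forall>t'<Suc t. \<not> violating t')) s''"
      by (rule verdict_weaken) (auto simp: less_Suc_eq)
    then show "verdict (P \<and> (\<forall>t'<Suc t. \<not> violating t')) (put ''t'' 0 (int t + 1) s'')"
      by (subst verdict_cong[where s = s'']) auto
  qed
qed (simp_all add: counts)

text \<open>If nothing was reported, the equalities hold and no tested coalition is violating; by
  \<open>violating_complete\<close> no inequality at all is violated.\<close>

lemma verdict_correct:
  assumes "verdict ((\<forall>l<k. satisfied (Equality (family I ! l))) \<and> (\<forall>t<(n + 1) * n ^ m. \<not> violating t)) s"
  shows "correct_answer m I (decode_answer n s)"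
  using assms unfolding verdict_def
proof (elim disjE conjE)
  assume none: "decode_answer n s = None" and eqs: "\<forall>l<k. satisfied (Equality (family I ! l))"
    and enum: "\<forall>t<(n + 1) * n ^ m. \<not> violating t"
  have "satisfied con" if "con \<in> lp_constraints n (family I)" for con
    using that unfolding lp_constraints_def
  proof (elim UnE CollectE exE conjE)
    fix S assume "con = Inequality S" "S \<subseteq> {..<n}" "char_vec S \<notin> coord.span (char_vec ` set (family I))"
    then show ?thesis using violating_complete enum by blast
  next
    fix S assume "con = Equality S" "S \<in> set (family I)"
    then show ?thesis using eqs by (auto simp: in_set_conv_nth k_def)
  qed
  then show ?thesis using none by (simp add: satisfied_def n_def)
qed auto

section \<open>The whole program\<close>

lemma runs_separation:
  "runs rounds H (separation m) (initial_memory zs) (\<lambda>s. correct_answer m I (decode_answer n s))"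
  unfolding separation_def
proof (rule runs_Seq[OF runs_scaling])
  show "loaded (initial_memory zs)" by (simp add: loaded_def)
  fix s1 assume a1: "agree (writes (scaling m)) (initial_memory zs) s1" and s1: "ready s1"
  have out: "s1 ''out'' 0 = 0" using a1 by (simp add: initial_memory_def)
  show "runs rounds H (Seq (equalities m) (Seq (elimination m) (enumeration m))) s1
      (\<lambda>s. correct_answer m I (decode_answer n s))"
  proof (rule runs_Seq[OF runs_equalities[OF s1 out]])
    fix s2 assume a2: "agree (writes (equalities m)) s1 s2"
      and v2: "verdict (\<forall>l<k. satisfied (Equality (family I ! l))) s2"
    have s2: "ready s2" "loaded s2" using a2 s1 by (simp_all add: ready_def loaded_def)
    show "runs rounds H (Seq (elimination m) (enumeration m)) s2
        (\<lambda>s. correct_answer m I (decode_answer n s))"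
    proof (rule runs_Seq[OF runs_elimination[OF s2(2)]])
      fix s3 assume a3: "agree (writes (elimination m)) s2 s3" and el: "eliminated k s3"
      have s3: "ready s3" using a3 s2 by (simp add: ready_def loaded_def)
      have v3: "verdict (\<forall>l<k. satisfied (Equality (family I ! l))) s3"
        using a3 v2 by (subst verdict_cong[where s = s2]) auto
      show "runs rounds H (enumeration m) s3 (\<lambda>s. correct_answer m I (decode_answer n s))"
      proof (rule runs_conseq[OF runs_enumeration[OF s3 el v3]])
        fix s4 assume "verdict ((\<forall>l<k. satisfied (Equality (family I ! l))) \<and>
          (\<forall>t<(n + 1) * n ^ m. \<not> violating t)) s4"
        then show "correct_answer m I (decode_answer n s4)" by (rule verdict_correct)
      qed
    qed
  qed
qed

lemma small_initial: "small H (initial_memory zs)"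
  unfolding small_def
proof (intro allI)
  fix a i
  have "(2 :: int) ^ L \<le> H" by (rule power_le_H) (simp add: trans_le_add2)
  then show "\<bar>initial_memory zs a i\<bar> \<le> H"
    using abs_zs_le[of "nat i"] one_le_H by (fastforce simp: initial_memory_def)
qed

end

theorem lemma6:
  fixes m :: nat
  shows "\<exists>(prog :: program) (p :: nat poly). \<forall>I. valid_instance m I \<longrightarrow>
    (\<exists>t s. exec prog (initial_memory (enc_instance m I)) t s \<and>
           t \<le> poly p (encoding_length (enc_instance m I)) \<and>
           correct_answer m I (decode_answer (players I) s))"
proof -
  \<comment> \<open>Evaluated at the encoding length, these are \<open>rounds\<close> and
    \<open>bits H\<close>; like the program, they depend on \<open>m\<close> only.\<close>
  define q r :: "nat poly" where "q = [:1, 1:] ^ (m + 2)" and "r = [:m + 2, m + 5, 1:]"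
  obtain p where p: "\<And>x. time_bound (poly q x) (poly r x) (separation m) \<le> poly p x"
    using poly_bound_time_bound by blast
  show ?thesis
  proof (intro exI[of _ "separation m"] exI[of _ p] allI impI)
    fix I assume "valid_instance m I"
    then interpret sep_problem m I by unfold_locales
    obtain t s where run: "exec (separation m) (initial_memory zs) t s"
        "t \<le> time_bound rounds (bits H) (separation m)" "correct_answer m I (decode_answer n s)"
      using runs_separation small_initial unfolding runs_def by blast
    have "rounds = poly q L" "bits H = poly r L"
      by (simp_all add: rounds_def bits_H q_def r_def poly_power algebra_simps)
    with run(2) p have "t \<le> poly p L" using order_trans by metis
    with run show "\<exists>t s. exec (separation m) (initial_memory (enc_instance m I)) t s \<and>
        t \<le> poly p (encoding_length (enc_instance m I)) \<and>
        correct_answer m I (decode_answer (players I) s)"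
      unfolding zs_def L_def n_def by blast
  qed
qed

end
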